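(* Let $f\in\mathbb{R}[x]$, $g\in\mathbb{R}[x,y]$, and let $\mathbf{B}=[-1,1]^n$, $\mathbf{X}\subseteq\mathbf{B}$, $\mathbf{Y}_x$, $\mathbf{K}$, $\Phi$, $f^*$ and $(\Phi_d)_d$ be as defined in the context, under the standing assumptions listed there. Assume that $\mathbf{X}$ is the closure of an open subset of $\mathbb{R}^n$. For $\epsilon\ge 0$ and $d\in\mathbb{N}$, $d\geq 1$, let $$f^\epsilon_d:=\min_{x\in\mathbf{X}}\{f(x)\,:\,\Phi_d(x)\le\epsilon\},$$ let $x^\epsilon_d\in\mathbf{X}$ be any optimal solution of this problem (including the case $\epsilon=0$), and let $$\tilde f^\epsilon_d:=\min\{f^\epsilon_\ell\,:\,\ell=1,\dots,d\}=f(x^\epsilon_{\ell(d)})\quad\text{for some }\ell(d)\in\{1,\dots,d\}.$$ (By convention $f^\epsilon_\ell=+\infty$ if the corresponding problem is infeasible or $\Phi_\ell$ is not defined; if $f^\epsilon_\ell=+\infty$ for all $\ell=1,\dots,d$, then $\tilde f^\epsilon_d=+\infty$.) Let $\epsilon>0$ be fixed, arbitrary. Then: (a) There exists $d_\epsilon\in\mathbb{N}$ such that for every $d\ge d_\epsilon$, $f(x^\epsilon_{\ell(d)})=\tilde f^\epsilon_d<f^*+\epsilon$. (b) If there is an optimal solution $x^*\in\mathbf{X}$ of the problem $f^*=\min_{x\in\mathbf{X}}\{f(x): g(x,y)\le 0\ \forall y\in\mathbf{Y}_x\}$ such that $\Phi(x^* )<0$, then there exists $d_0\in\mathbb{N}$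 such that for every $d\ge d_0$, $f^*\le f(x^0_{\ell(d)})=\tilde f^0_d<f^*+\epsilon$, where here $\ell(d)$ is the index associated with $\tilde f^0_d$ (the case $\epsilon=0$).
   Context: Variables are $x=(x_1,\dots,x_n)$ and $y=(y_1,\dots,y_p)$. $\Sigma[x,y]\subset\mathbb{R}[x,y]$ is the set of sums of squares of polynomials, and $\mathbb{R}[x]_{2d}$ is the space of polynomials in $x$ of degree at most $2d$. Let $p_s\in\mathbb{R}[x]$ ($s=1,\dots,sx$) and $h_j\in\mathbb{R}[x,y]$ ($j=1,\dots,m$) be given, and set $h_0\equiv 1$. Let $\mathbf{B}=[-1,1]^n$ and $\theta_i(x,y)=1-x_i^2$ ($i=1,\dots,n$), and let $\mu$ be the uniform probability measure on $\mathbf{B}$. Define $$\mathbf{X}=\{x\in\mathbb{R}^n: p_s(x)\ge0,\ s=1,\dots,sx\}\subseteq\mathbf{B},$$ $$\mathbf{Y}_x=\{y\in\mathbb{R}^p: h_j(x,y)\ge0,\ j=1,\dots,m\},$$ $$\mathbf{K}=\{(x,y)\in\mathbb{R}^{n+p}: x\in\mathbf{B},\ h_j(x,y)\ge0,\ j=1,\dots,m\},$$ $$\Phi(x)=\max_y\{g(x,y): y\in\mathbf{Y}_x\}\quad (x\in\mathbf{B}).$$ The semi-infinite problem is $$f^*=\min_{x\in\mathbf{X}}\{f(x): g(x,y)\le0\ \forall y\in\mathbf{Y}_x\}=\min_{x\in\mathbf{X}}\{f(x):\Phi(x)\le0\},$$ which is assumed to be feasible (the minimum is understood as an infimum if it is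 not attained). A family of polynomials $q_1,\dots,q_N\in\mathbb{R}[z]$ (with $q_0=1$) satisfies the Archimedean property if there are $M\in\mathbb{R}$ and sums of squares $\sigma_0,\dots,\sigma_N\in\Sigma[z]$ with $M-\|z\|^2=\sum_{j=0}^N\sigma_jq_j$. Standing assumptions: $\mathbf{K}$ is compact; the family $\{h_j\}_{j=1}^m\cup\{\theta_i\}_{i=1}^n\subset\mathbb{R}[x,y]$ satisfies the Archimedean property (in the variables $z=(x,y)$); and $\mathbf{Y}_x\ne\emptyset$ for every $x\in\mathbf{B}$. Definition of $\Phi_d$: $\Phi_d\in\mathbb{R}[x]_{2d}$ is (the $q$-component of) an optimal solution of the semidefinite program $$\min_{q,\sigma_j,\psi_i}\int_{\mathbf{B}}q\,d\mu\quad\text{s.t.}\quad q(x)-g(x,y)=\sum_{j=0}^m\sigma_j(x,y)h_j(x,y)+\sum_{i=1}^n\psi_i(x,y)\theta_i(x,y),$$ $$q\in\mathbb{R}[x]_{2d},\quad \sigma_j,\psi_i\in\Sigma[x,y],\quad \deg(\sigma_jh_j)\le2d\ (j=0,\dots,m),\quad \deg(\psi_i\theta_i)\le2d\ (i=1,\dots,n).$$ It is assumed that such an optimal solution exists for all sufficiently large $d$; one is fixed for each $d$ for which an optimal solution exists. *)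

theory Defs
  imports "HOL-Analysis.Analysis" "HOL-Library.Poly_Mapping"
begin

(* Real polynomials in finitely many variables indexed by 'v: finitely supported maps from
   exponent vectors to coefficients. HOL-Library.Poly_Mapping supplies the ring structure
   (multiplication is convolution). *)
type_synonym 'v rpoly = "('v \<Rightarrow>\<^sub>0 nat) \<Rightarrow>\<^sub>0 real"

definition pconst :: "real \<Rightarrow> 'v rpoly" where
  "pconst c = Poly_Mapping.single 0 c"

definition pvar :: "'v \<Rightarrow> 'v rpoly" where
  "pvar v = Poly_Mapping.single (Poly_Mapping.single v 1) 1"

definition peval :: "('v \<Rightarrow> real) \<Rightarrow> 'v rpoly \<Rightarrow> real" where
  "peval z q = (\<Sum>a\<in>Poly_Mapping.keys q. Poly_Mapping.lookup q a *
     (\<Prod>v\<in>Poly_Mapping.keys a. z v ^ Poly_Mapping.lookup a v))"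

(* Total degree; the zero polynomial gets degree 0, hence satisfies every bound deg \<le> 2d. *)
definition tdegree :: "'v rpoly \<Rightarrow> nat" where
  "tdegree q = Max (insert 0
     ((\<lambda>a. \<Sum>v\<in>Poly_Mapping.keys a. Poly_Mapping.lookup a v) ` Poly_Mapping.keys q))"

definition sos :: "'v rpoly set" where
  "sos = {q. \<exists>rs. q = (\<Sum>r\<leftarrow>rs. r\<^sup>2)}"

(* The family (q i) for i in I; the summand s0 belongs to the additional polynomial q_0 = 1. *)
definition archimedean_family :: "'i set \<Rightarrow> ('i \<Rightarrow> ('v::finite) rpoly) \<Rightarrow> bool" where
  "archimedean_family I q \<longleftrightarrow>
     (\<exists>M s0 s. s0 \<in> sos \<and> (\<forall>i\<in>I. s i \<in> sos) \<and>
        pconst M - (\<Sum>v\<in>UNIV. (pvar v)\<^sup>2) = s0 + (\<Sum>i\<in>I. s i * q i))"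

(* R[x] has variables 'n, R[x,y] has variables 'n + 'p: Inl i is x_i and Inr k is y_k. *)
definition evalx :: "('n::finite) rpoly \<Rightarrow> real ^ 'n \<Rightarrow> real" where
  "evalx q x = peval (\<lambda>i. x $ i) q"

definition evalxy :: "('n::finite + 'p::finite) rpoly \<Rightarrow> real ^ 'n \<Rightarrow> real ^ 'p \<Rightarrow> real" where
  "evalxy q x y = peval (case_sum (\<lambda>i. x $ i) (\<lambda>k. y $ k)) q"

(* The inclusion of R[x] into R[x,y]. *)
definition incl_x :: "'n rpoly \<Rightarrow> ('n + 'p) rpoly" where
  "incl_x q = (\<Sum>a\<in>Poly_Mapping.keys q.
     Poly_Mapping.single
       (\<Sum>i\<in>Poly_Mapping.keys a. Poly_Mapping.single (Inl i) (Poly_Mapping.lookup a i))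
       (Poly_Mapping.lookup q a))"

definition theta :: "'n \<Rightarrow> ('n + 'p) rpoly" where
  "theta i = 1 - (pvar (Inl i))\<^sup>2"

definition Bset :: "(real ^ 'n) set" where
  "Bset = {x. \<forall>i. - 1 \<le> x $ i \<and> x $ i \<le> 1}"

definition mu :: "(real ^ 'n) measure" where
  "mu = uniform_measure lborel Bset"

definition Xset :: "nat \<Rightarrow> (nat \<Rightarrow> ('n::finite) rpoly) \<Rightarrow> (real ^ 'n) set" where
  "Xset sx p = {x. \<forall>s\<in>{1..sx}. evalx (p s) x \<ge> 0}"

definition Yset :: "nat \<Rightarrow> (nat \<Rightarrow> ('n::finite + 'p::finite) rpoly) \<Rightarrow> real ^ 'n \<Rightarrow> (real ^ 'p) set" where
  "Yset m h x = {y. \<forall>j\<in>{1..m}. evalxy (h j) x y \<ge> 0}"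

definition Kset :: "nat \<Rightarrow> (nat \<Rightarrow> ('n::finite + 'p::finite) rpoly) \<Rightarrow> ((real ^ 'n) \<times> (real ^ 'p)) set" where
  "Kset m h = {(x, y). x \<in> Bset \<and> (\<forall>j\<in>{1..m}. evalxy (h j) x y \<ge> 0)}"

(* Used only for x in Bset. There the maximum exists, since Yset m h x is nonempty and,
   being a slice of the compact set Kset m h, compact; so the supremum is the maximum. *)
definition Phi :: "nat \<Rightarrow> (nat \<Rightarrow> ('n::finite + 'p::finite) rpoly) \<Rightarrow> ('n + 'p) rpoly \<Rightarrow> real ^ 'n \<Rightarrow> real" where
  "Phi m h g x = (SUP y\<in>Yset m h x. evalxy g x y)"

definition sip_feasible ::
  "nat \<Rightarrow> (nat \<Rightarrow> ('n::finite) rpoly) \<Rightarrow> nat \<Rightarrow> (nat \<Rightarrow> ('n::finite + 'p::finite) rpoly) \<Rightarrow> ('n + 'p) rpoly \<Rightarrow> (real ^ 'n) set"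
where
  "sip_feasible sx p m h g = {x \<in> Xset sx p. \<forall>y\<in>Yset m h x. evalxy g x y \<le> 0}"

(* Infimum of f over S in the extended reals; it is \<infinity> if S is empty. *)
definition opt_val :: "('n::finite) rpoly \<Rightarrow> (real ^ 'n) set \<Rightarrow> ereal" where
  "opt_val f S = (INF x\<in>S. ereal (evalx f x))"

definition opt_sol :: "('n::finite) rpoly \<Rightarrow> (real ^ 'n) set \<Rightarrow> real ^ 'n \<Rightarrow> bool" where
  "opt_sol f S = is_arg_min (evalx f) (\<lambda>x. x \<in> S)"

definition sdp_feasible ::
  "nat \<Rightarrow> (nat \<Rightarrow> ('n::finite + 'p::finite) rpoly) \<Rightarrow> ('n + 'p) rpoly \<Rightarrow> nat \<Rightarrow>
   'n rpoly \<Rightarrow> (nat \<Rightarrow> ('n::finite + 'p::finite) rpoly) \<Rightarrow> ('n \<Rightarrow> ('n + 'p) rpoly) \<Rightarrow> bool" where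
  "sdp_feasible m h g d q \<sigma> \<psi> \<longleftrightarrow>
     incl_x q - g = (\<Sum>j=0..m. \<sigma> j * h j) + (\<Sum>i\<in>UNIV. \<psi> i * theta i) \<and>
     tdegree q \<le> 2 * d \<and>
     (\<forall>j\<in>{0..m}. \<sigma> j \<in> sos \<and> tdegree (\<sigma> j * h j) \<le> 2 * d) \<and>
     (\<forall>i. \<psi> i \<in> sos \<and> tdegree (\<psi> i * theta i) \<le> 2 * d)"

(* q is the q-component of an optimal solution. *)
definition sdp_optimal ::
  "nat \<Rightarrow> (nat \<Rightarrow> ('n::finite + 'p::finite) rpoly) \<Rightarrow> ('n + 'p) rpoly \<Rightarrow> nat \<Rightarrow> 'n rpoly \<Rightarrow> bool" where
  "sdp_optimal m h g d q \<longleftrightarrow>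
     (\<exists>\<sigma> \<psi>. sdp_feasible m h g d q \<sigma> \<psi>) \<and>
     (\<forall>q' \<sigma>' \<psi>'. sdp_feasible m h g d q' \<sigma>' \<psi>' \<longrightarrow>
        (\<integral>x. evalx q x \<partial>mu) \<le> (\<integral>x. evalx q' x \<partial>mu))"

(* In what follows \<Phi>d d = None means that Phi_d is not defined; the level-d feasible set is
   then empty, so that the value is \<infinity>. *)
definition lev_feasible ::
  "nat \<Rightarrow> (nat \<Rightarrow> ('n::finite) rpoly) \<Rightarrow> (nat \<Rightarrow> 'n rpoly option) \<Rightarrow> real \<Rightarrow> nat \<Rightarrow> (real ^ 'n) set" where
  "lev_feasible sx p \<Phi>d e d = {x \<in> Xset sx p. \<exists>q. \<Phi>d d = Some q \<and> evalx q x \<le> e}"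

definition f_lev ::
  "nat \<Rightarrow> (nat \<Rightarrow> ('n::finite) rpoly) \<Rightarrow> 'n rpoly \<Rightarrow> (nat \<Rightarrow> 'n rpoly option) \<Rightarrow> real \<Rightarrow> nat \<Rightarrow> ereal" where
  "f_lev sx p f \<Phi>d e d = opt_val f (lev_feasible sx p \<Phi>d e d)"

(* Meaningful for d \<ge> 1 only. *)
definition f_tilde ::
  "nat \<Rightarrow> (nat \<Rightarrow> ('n::finite) rpoly) \<Rightarrow> 'n rpoly \<Rightarrow> (nat \<Rightarrow> 'n rpoly option) \<Rightarrow> real \<Rightarrow> nat \<Rightarrow> ereal" where
  "f_tilde sx p f \<Phi>d e d = (MIN l\<in>{1..d}. f_lev sx p f \<Phi>d e l)"

end

(* For a point x0 of X with g(x0, y) < c on Y_x0 there is, since K is compact and X is the closure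
   of its open part, a nonempty open set V in X close to x0 with g <= c on all fibres over V.
   The claim reduces to: for c < e and large d, Phi_d <= e somewhere on V.  Otherwise lower Phi_d
   on V by a fixed bump function towards a value between c and e.  The result still dominates g on K and has
   integral smaller than that of Phi_d by a fixed amount; by Stone-Weierstrass it may be taken to be
   a polynomial strictly larger than g on K.  But by Putinar's Positivstellensatz every such
   polynomial is feasible for large d, so the optimal values converge to the infimum of the
   integrals of these polynomials: a contradiction.

   Putinar's theorem follows from the fact that a maximal proper quadratic module Q satisfies
   Q u -Q = R[z]; if Q is Archimedean, taking the standard part modulo Q is evaluation at a point. *)

theory Submission
  imports Defs "HOL-Probability.Probability_Measure"
begin

subsection \<open>Evaluation of polynomials\<close>

lemma prod_power_keys:
  fixes z :: "'v::finite \<Rightarrow> 'a::comm_semiring_1" and a :: "'v \<Rightarrow>\<^sub>0 nat"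
  shows "(\<Prod>v\<in>Poly_Mapping.keys a. z v ^ Poly_Mapping.lookup a v) = (\<Prod>v\<in>UNIV. z v ^ Poly_Mapping.lookup a v)"
  by (rule prod.mono_neutral_left) (auto simp: in_keys_iff)

lemma poly_mapping_sum_single:
  "(\<Sum>a\<in>Poly_Mapping.keys q. Poly_Mapping.single a (Poly_Mapping.lookup q a)) = q"
  by (rule poly_mapping_eqI)
    (simp add: lookup_sum lookup_single when_def sum.delta' in_keys_iff)

lemma peval_superset:
  fixes z :: "'v::finite \<Rightarrow> real"
  assumes "finite S" "Poly_Mapping.keys q \<subseteq> S"
  shows "peval z q = (\<Sum>a\<in>S. Poly_Mapping.lookup q a * (\<Prod>v\<in>UNIV. z v ^ Poly_Mapping.lookup a v))"
  unfolding peval_def prod_power_keys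
  by (rule sum.mono_neutral_left) (use assms in \<open>auto simp: in_keys_iff\<close>)

lemma peval_single:
  fixes z :: "'v::finite \<Rightarrow> real"
  shows "peval z (Poly_Mapping.single a c) = c * (\<Prod>v\<in>UNIV. z v ^ Poly_Mapping.lookup a v)"
  by (subst peval_superset[of "{a}"]) auto

lemma peval_add:
  fixes z :: "'v::finite \<Rightarrow> real"
  shows "peval z (q + r) = peval z q + peval z r"
proof -
  let ?S = "Poly_Mapping.keys q \<union> Poly_Mapping.keys r"
  have "Poly_Mapping.keys (q + r) \<subseteq> ?S" by (rule keys_add)
  then show ?thesis
    by (simp add: peval_superset[of ?S] lookup_add distrib_right sum.distrib)
qed

lemma peval_0 [simp]: "peval z 0 = 0"
  by (simp add: peval_def)

lemma peval_sum:
  fixes z :: "'v::finite \<Rightarrow> real"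
  shows "peval z (\<Sum>i\<in>I. q i) = (\<Sum>i\<in>I. peval z (q i))"
  by (induction I rule: infinite_finite_induct) (auto simp: peval_add)

lemma peval_mult:
  fixes z :: "'v::finite \<Rightarrow> real"
  shows "peval z (q * r) = peval z q * peval z r"
proof -
  let ?s = "\<lambda>q a. Poly_Mapping.single a (Poly_Mapping.lookup q a)"
  have single: "peval z (?s q a * ?s r b) = peval z (?s q a) * peval z (?s r b)" for a b
    by (simp add: mult_single peval_single lookup_add power_add prod.distrib)
  have "peval z (q * r) = peval z ((\<Sum>a\<in>Poly_Mapping.keys q. ?s q a) * (\<Sum>b\<in>Poly_Mapping.keys r. ?s r b))"
    by (simp only: poly_mapping_sum_single)
  also have "\<dots> = peval z (\<Sum>a\<in>Poly_Mapping.keys q. ?s q a) * peval z (\<Sum>b\<in>Poly_Mapping.keys r. ?s r b)"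
    by (simp only: sum_product peval_sum single)
  finally show ?thesis by (simp only: poly_mapping_sum_single)
qed

lemma peval_pconst [simp]:
  fixes z :: "'v::finite \<Rightarrow> real"
  shows "peval z (pconst c) = c"
  by (simp add: pconst_def peval_single)

lemma peval_pvar [simp]:
  fixes z :: "'v::finite \<Rightarrow> real"
  shows "peval z (pvar w) = z w"
proof -
  have "(\<Prod>v\<in>UNIV. z v ^ Poly_Mapping.lookup (Poly_Mapping.single w (1::nat)) v) = (\<Prod>v\<in>UNIV. if v = w then z v else 1)"
    by (rule prod.cong) (auto simp: lookup_single when_def)
  then show ?thesis by (simp add: pvar_def peval_single)
qed

lemma pconst_0 [simp]: "pconst 0 = 0" and pconst_1 [simp]: "pconst 1 = 1"
  by (simp_all add: pconst_def)

lemma pconst_numeral: "pconst (numeral k) = numeral k"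
  by (simp add: pconst_def)

lemma pconst_add: "pconst (c + d) = pconst c + pconst d"
  and pconst_diff: "pconst (c - d) = pconst c - pconst d"
  and pconst_uminus: "pconst (- c) = - pconst c"
  and pconst_mult: "pconst (c * d) = pconst c * pconst d"
  by (simp_all add: pconst_def single_add single_diff single_uminus mult_single)

lemma peval_1 [simp]:
  fixes z :: "'v::finite \<Rightarrow> real"
  shows "peval z 1 = 1"
  using peval_pconst[of z 1] by simp

lemma peval_uminus:
  fixes z :: "'v::finite \<Rightarrow> real"
  shows "peval z (- q) = - peval z q"
  using peval_add[of z q "- q"] by simp

lemma peval_diff:
  fixes z :: "'v::finite \<Rightarrow> real"
  shows "peval z (q - r) = peval z q - peval z r"
  using peval_add[of z q "- r"] by (simp add: peval_uminus)

lemma peval_power: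
  fixes z :: "'v::finite \<Rightarrow> real"
  shows "peval z (q ^ k) = peval z q ^ k"
  by (induction k) (simp_all add: peval_mult)

lemmas peval_simps = peval_add peval_diff peval_uminus peval_mult peval_power peval_sum

lemma single_eq_pconst_prod_pvar:
  fixes a :: "'v::finite \<Rightarrow>\<^sub>0 nat"
  shows "Poly_Mapping.single a c = pconst c * (\<Prod>v\<in>UNIV. pvar v ^ Poly_Mapping.lookup a v)"
proof -
  have power: "pvar v ^ k = Poly_Mapping.single (Poly_Mapping.single v k) 1" for v :: 'v and k
    by (induction k) (simp_all add: pvar_def mult_single single_add[symmetric])
  have prod: "(\<Prod>v\<in>S. Poly_Mapping.single (b v) (1::real)) = Poly_Mapping.single (\<Sum>v\<in>S. b v) 1"
    for b :: "'v \<Rightarrow> 'v \<Rightarrow>\<^sub>0 nat" and S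
    by (induction S rule: infinite_finite_induct) (simp_all add: mult_single)
  have "(\<Sum>v\<in>UNIV. Poly_Mapping.single v (Poly_Mapping.lookup a v)) = a"
    by (rule poly_mapping_eqI) (simp add: lookup_sum lookup_single when_def sum.delta')
  then show ?thesis
    by (simp add: power prod pconst_def mult_single)
qed

lemma rpoly_induct [case_names pconst pvar add mult]:
  fixes q :: "'v::finite rpoly"
  assumes const: "\<And>c. P (pconst c)" and var: "\<And>v. P (pvar v)"
    and add: "\<And>q r. P q \<Longrightarrow> P r \<Longrightarrow> P (q + r)" and mult: "\<And>q r. P q \<Longrightarrow> P r \<Longrightarrow> P (q * r)"
  shows "P q"
proof -
  have one: "P 1" and zero: "P 0" using const[of 1] const[of 0] by simp_all
  have power: "P (pvar v ^ k)" for v k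
    by (induction k) (auto intro: one var mult)
  have "P (\<Prod>v\<in>S. pvar v ^ k v)" for S and k :: "'v \<Rightarrow> nat"
    by (induction S rule: infinite_finite_induct) (auto intro: one mult power)
  then have "P (Poly_Mapping.single a c)" for a c
    unfolding single_eq_pconst_prod_pvar by (intro mult const)
  then have "P (\<Sum>a\<in>S. Poly_Mapping.single a (c a))" for S c
    by (induction S rule: infinite_finite_induct) (auto intro: zero add)
  then show ?thesis
    by (metis poly_mapping_sum_single)
qed

text \<open>Constants and variables generate the algebra, so such a map is fixed by its values on
  the variables. This is how an abstract standard-part map turns into a point of real space.\<close>

lemma ring_hom_eq_peval:
  fixes q :: "'v::finite rpoly"
  assumes "\<And>c. \<alpha> (pconst c) = c"
    and "\<And>q r. \<alpha> (q + r) = \<alpha> q + \<alpha> r" and "\<And>q r. \<alpha> (q * r) = \<alpha> q * \<alpha> r"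
  shows "\<alpha> q = peval (\<lambda>v. \<alpha> (pvar v)) q"
  by (induction q rule: rpoly_induct) (simp_all add: assms peval_add peval_mult)

subsection \<open>Sums of squares and quadratic modules\<close>

lemma sos_0 [simp]: "0 \<in> sos"
  unfolding sos_def by (auto intro: exI[of _ "[]"])

lemma sos_square: "r\<^sup>2 \<in> sos"
  unfolding sos_def by (auto intro: exI[of _ "[r]"])

lemma sos_1 [simp]: "1 \<in> sos"
  using sos_square[of 1] by simp

lemma sos_add: "a \<in> sos \<Longrightarrow> b \<in> sos \<Longrightarrow> a + b \<in> sos"
  unfolding sos_def by clarsimp (metis map_append sum_list_append)

lemma sos_sum: "(\<And>i. i \<in> I \<Longrightarrow> s i \<in> sos) \<Longrightarrow> (\<Sum>i\<in>I. s i) \<in> sos"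
  by (induction I rule: infinite_finite_induct) (auto intro: sos_add)

lemma sos_induct [consumes 1, case_names zero add]:
  assumes "a \<in> sos" and "P 0" and "\<And>r a. a \<in> sos \<Longrightarrow> P a \<Longrightarrow> P (r\<^sup>2 + a)"
  shows "P a"
proof -
  obtain rs where rs: "a = (\<Sum>r\<leftarrow>rs. r\<^sup>2)" using assms(1) unfolding sos_def by blast
  have "(\<Sum>r\<leftarrow>rs. r\<^sup>2) \<in> sos \<and> P (\<Sum>r\<leftarrow>rs. r\<^sup>2)"
    by (induction rs) (auto intro: assms(2,3) sos_add sos_square)
  then show ?thesis using rs by simp
qed

lemma sos_square_mult: "a \<in> sos \<Longrightarrow> r\<^sup>2 * a \<in> sos"
  by (induction rule: sos_induct)
    (auto simp: distrib_left power_mult_distrib[symmetric] intro: sos_add sos_square)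

lemma sos_mult: "a \<in> sos \<Longrightarrow> b \<in> sos \<Longrightarrow> a * b \<in> sos"
  by (induction a rule: sos_induct) (auto simp: distrib_right intro: sos_add sos_square_mult)

lemma peval_sos_nonneg:
  fixes z :: "'v::finite \<Rightarrow> real"
  shows "s \<in> sos \<Longrightarrow> peval z s \<ge> 0"
  by (induction rule: sos_induct) (auto simp: peval_simps)

lemma pconst_eq_square: "c \<ge> 0 \<Longrightarrow> pconst c = (pconst (sqrt c))\<^sup>2"
  by (simp add: power2_eq_square pconst_mult[symmetric])

definition quadratic_module :: "'v rpoly set \<Rightarrow> bool" where
  "quadratic_module Q \<longleftrightarrow>
     1 \<in> Q \<and> (\<forall>a\<in>Q. \<forall>b\<in>Q. a + b \<in> Q) \<and> (\<forall>r. \<forall>a\<in>Q. r\<^sup>2 * a \<in> Q)"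

text \<open>Applying the condition to \<open>- a\<close> as well gives lower bounds, so every
  polynomial lies between two constants in the preorder defined by \<open>Q\<close>.\<close>

definition archimedean_module :: "'v rpoly set \<Rightarrow> bool" where
  "archimedean_module Q \<longleftrightarrow> (\<forall>a. \<exists>N. pconst N - a \<in> Q)"

lemma archimedean_module_mono:
  "archimedean_module Q \<Longrightarrow> Q \<subseteq> Q' \<Longrightarrow> archimedean_module Q'"
  unfolding archimedean_module_def by blast

context
  fixes Q :: "'v::finite rpoly set"
  assumes qm: "quadratic_module Q"
begin

lemma qm_add: "a \<in> Q \<Longrightarrow> b \<in> Q \<Longrightarrow> a + b \<in> Q"
  using qm unfolding quadratic_module_def by blast

lemma qm_square_mult: "a \<in> Q \<Longrightarrow> r\<^sup>2 * a \<in> Q"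
  using qm unfolding quadratic_module_def by blast

lemma qm_1: "1 \<in> Q"
  using qm unfolding quadratic_module_def by blast

lemma qm_0: "0 \<in> Q"
  using qm_square_mult[OF qm_1, of 0] by simp

lemma qm_sos_mult: "s \<in> sos \<Longrightarrow> a \<in> Q \<Longrightarrow> s * a \<in> Q"
  by (induction rule: sos_induct) (auto simp: distrib_right intro: qm_0 qm_add qm_square_mult)

lemma qm_sos: "s \<in> sos \<Longrightarrow> s \<in> Q"
  using qm_sos_mult[OF _ qm_1] by simp

lemma qm_scale: "c \<ge> 0 \<Longrightarrow> a \<in> Q \<Longrightarrow> pconst c * a \<in> Q"
  using qm_square_mult by (metis pconst_eq_square)

lemma qm_scale_cancel:
  assumes "c > 0" "pconst c * a \<in> Q"
  shows "a \<in> Q"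
proof -
  have "pconst (1 / c) * (pconst c * a) = a"
    using assms(1) by (simp add: mult.assoc[symmetric] pconst_mult[symmetric])
  then show ?thesis using qm_scale[of "1 / c" "pconst c * a"] assms by simp
qed

lemma qm_pconst: "c \<ge> 0 \<Longrightarrow> pconst c \<in> Q"
  using qm_scale[OF _ qm_1] by simp

text \<open>A negative constant in \<open>Q\<close> would rescale to \<open>- 1\<close>. This lets
  membership of constants be read back as inequalities between real numbers.\<close>

lemma pconst_in_proper_qm_iff:
  assumes "- 1 \<notin> Q"
  shows "pconst c \<in> Q \<longleftrightarrow> c \<ge> 0"
proof
  assume c: "pconst c \<in> Q"
  show "c \<ge> 0"
  proof (rule ccontr)
    assume "\<not> c \<ge> 0"
    then have "- c > 0" "pconst (- c) * (- 1) \<in> Q" using c by (auto simp: pconst_uminus)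
    then show False using qm_scale_cancel assms by blast
  qed
qed (rule qm_pconst)

text \<open>This is the smallest quadratic module containing \<open>Q\<close> and \<open>a\<close>.
  It serves twice: to extend a supposedly maximal module, and to adjoin \<open>- f\<close> in the
  Positivstellensatz.\<close>

lemma qm_adjoin:
  "quadratic_module {b + s * a | b s. b \<in> Q \<and> s \<in> sos}" (is "quadratic_module ?R")
  unfolding quadratic_module_def
proof (intro conjI ballI allI)
  have "1 + 0 * a \<in> ?R" using qm_1 sos_0 by blast
  then show "1 \<in> ?R" by simp
next
  fix u v assume "u \<in> ?R" "v \<in> ?R"
  then obtain b s c t where "b \<in> Q" "s \<in> sos" "c \<in> Q" "t \<in> sos" and uv: "u = b + s * a" "v = c + t * a"
    by blast
  then have "(b + c) + (s + t) * a \<in> ?R" using qm_add sos_add by blast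
  then show "u + v \<in> ?R" by (simp add: uv algebra_simps)
next
  fix r u assume "u \<in> ?R"
  then obtain b s where "b \<in> Q" "s \<in> sos" and u: "u = b + s * a" by blast
  then have "r\<^sup>2 * b + (r\<^sup>2 * s) * a \<in> ?R" using qm_square_mult sos_square_mult by blast
  then show "r\<^sup>2 * u \<in> ?R" by (simp add: u algebra_simps)
qed

text \<open>A quadratic module need not be closed under products, so \<open>pconst N - a\<close> and
  \<open>pconst N + a\<close> cannot simply be multiplied. Weighting each by the square of the other
  and adding gives the product times \<open>2 * N\<close>, from which the positive constant
  cancels.\<close>

lemma qm_bounded_square:
  assumes N: "N > 0" and b: "pconst N - a \<in> Q" "pconst N + a \<in> Q"
  shows "pconst (N\<^sup>2) - a\<^sup>2 \<in> Q"
proof -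
  have "(pconst N - a)\<^sup>2 * (pconst N + a) + (pconst N + a)\<^sup>2 * (pconst N - a) \<in> Q"
    by (intro qm_add qm_square_mult b)
  also have "(pconst N - a)\<^sup>2 * (pconst N + a) + (pconst N + a)\<^sup>2 * (pconst N - a)
      = pconst (2 * N) * (pconst (N\<^sup>2) - a\<^sup>2)"
  proof -
    show ?thesis by (simp add: power2_eq_square pconst_mult pconst_numeral algebra_simps)
  qed
  finally show ?thesis using N qm_scale_cancel[of "2 * N"] by simp
qed

text \<open>The polynomials bounded on both sides by constants form a subalgebra; the hypothesis
  bounds each variable, so this subalgebra is everything.\<close>

lemma archimedean_moduleI:
  assumes M: "pconst M - (\<Sum>v\<in>UNIV. (pvar v)\<^sup>2) \<in> Q"
  shows "archimedean_module Q"
proof -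
  define H where "H = {a. \<exists>N>0. pconst N - a \<in> Q \<and> pconst N + a \<in> Q}"
  have HI: "a \<in> H" if "pconst N - a \<in> Q" "pconst K + a \<in> Q" for a N K
  proof -
    define L where "L = max 1 (max N K)"
    have "pconst (L - N) + (pconst N - a) \<in> Q" "pconst (L - K) + (pconst K + a) \<in> Q"
      using that by (auto intro!: qm_add qm_pconst simp: L_def)
    then have "pconst L - a \<in> Q" "pconst L + a \<in> Q" "L > 0"
      by (simp_all add: pconst_diff L_def)
    then show ?thesis unfolding H_def by blast
  qed
  have H_const: "pconst c \<in> H" for c
  proof (rule HI)
    show "pconst c - pconst c \<in> Q" "pconst (- c) + pconst c \<in> Q"
      using qm_0 by (auto simp: pconst_uminus)
  qed
  have H_add: "a + b \<in> H" if H: "a \<in> H" "b \<in> H" for a b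
  proof -
    obtain N K where "pconst N - a \<in> Q" "pconst N + a \<in> Q" "pconst K - b \<in> Q" "pconst K + b \<in> Q"
      using H unfolding H_def by blast
    then have "(pconst N - a) + (pconst K - b) \<in> Q" "(pconst N + a) + (pconst K + b) \<in> Q"
      by (auto intro: qm_add)
    then show ?thesis
      by (intro HI[of "N + K" _ "N + K"]) (simp_all add: pconst_add algebra_simps)
  qed
  have H_uminus: "- a \<in> H" if H: "a \<in> H" for a
    using H unfolding H_def by auto
  have H_square: "a\<^sup>2 \<in> H" if H: "a \<in> H" for a
  proof -
    obtain N where N: "N > 0" "pconst N - a \<in> Q" "pconst N + a \<in> Q"
      using H unfolding H_def by blast
    show ?thesis
      using qm_bounded_square[OF N] qm_sos[OF sos_square] by (intro HI[of "N\<^sup>2" _ 0]) simp_all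
  qed
  have H_scale: "pconst c * a \<in> H" if H: "a \<in> H" and c: "c > 0" for a c
  proof -
    obtain N where N: "pconst N - a \<in> Q" "pconst N + a \<in> Q"
      using H unfolding H_def by blast
    have "pconst c * (pconst N - a) \<in> Q" "pconst c * (pconst N + a) \<in> Q"
      using N c by (auto intro: qm_scale)
    then show ?thesis
      by (intro HI[of "c * N" _ "c * N"]) (simp_all add: pconst_mult algebra_simps)
  qed
  \<comment> \<open>Polarization: a product is a combination of the squares of a sum and a
    difference.\<close>
  have H_mult: "a * b \<in> H" if H: "a \<in> H" "b \<in> H" for a b
  proof -
    have "pconst (1/4) * ((a + b)\<^sup>2 + - ((a + - b)\<^sup>2)) \<in> H"
      using H by (intro H_scale H_add H_uminus H_square) auto
    moreover have "(a + b)\<^sup>2 + - ((a + - b)\<^sup>2) = pconst 4 * (a * b)"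
    proof -
      show ?thesis by (simp add: pconst_numeral power2_eq_square algebra_simps)
    qed
    ultimately show ?thesis
      by (simp add: mult.assoc[symmetric] pconst_mult[symmetric])
  qed
  have H_var: "pvar v \<in> H" for v
  proof -
    have "pconst M - (\<Sum>w\<in>UNIV. (pvar w)\<^sup>2) + (\<Sum>w\<in>UNIV - {v}. (pvar w)\<^sup>2) \<in> Q"
      by (intro qm_add M qm_sos sos_sum sos_square)
    moreover have "(\<Sum>w\<in>UNIV. (pvar w)\<^sup>2) = (pvar v)\<^sup>2 + (\<Sum>w\<in>UNIV - {v}. (pvar w :: 'v rpoly)\<^sup>2)"
      by (simp add: sum.remove)
    ultimately have v: "pconst M - (pvar v)\<^sup>2 \<in> Q"
      by simp
    \<comment> \<open>Linear bounds from the quadratic one: adding the square of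
      \<open>pvar v - 1\<close> or \<open>pvar v + 1\<close> cancels the square of
      \<open>pvar v\<close>.\<close>
    have "pconst (M + 1) - pconst 2 * pvar v \<in> Q" "pconst (M + 1) + pconst 2 * pvar v \<in> Q"
      using qm_add[OF v qm_sos[OF sos_square[of "pvar v - 1"]]]
        qm_add[OF v qm_sos[OF sos_square[of "pvar v + 1"]]]
      by (simp_all add: power2_eq_square pconst_add algebra_simps) (simp_all add: pconst_def algebra_simps)
    then have "pconst 2 * pvar v \<in> H" by (rule HI)
    then have "pconst (1/2) * (pconst 2 * pvar v) \<in> H" by (rule H_scale) simp
    then show ?thesis by (simp add: mult.assoc[symmetric] pconst_mult[symmetric])
  qed
  have "a \<in> H" for a
    by (induction a rule: rpoly_induct) (auto intro: H_const H_var H_add H_mult)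
  then show ?thesis unfolding archimedean_module_def H_def by blast
qed

end

subsection \<open>The Positivstellensatz of Putinar\<close>

text \<open>Applied when \<open>s\<close> is a sum of squares and \<open>- s\<close> lies in
  \<open>Q\<close>: the left-hand side is then in \<open>Q\<close> for every \<open>a\<close>, so
  \<open>s * a\<close> is as well.\<close>

lemma polarization:
  fixes s a :: "'a::comm_ring_1"
  shows "s * (a + 1)\<^sup>2 + (a - 1)\<^sup>2 * (- s) = 4 * (s * a)"
  by (simp add: power2_eq_square algebra_simps)

text \<open>If both \<open>a\<close> and \<open>- a\<close> were missing, adjoining either would
  yield \<open>- 1\<close>. Eliminating \<open>a\<close> between the two representations puts
  \<open>- s\<close> into \<open>Q\<close>; then \<open>s * a\<close> lies in \<open>Q\<close> too,
  and the first representation gives \<open>- 1\<close> in \<open>Q\<close>.\<close>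

lemma maximal_qm_total:
  fixes Q :: "'v::finite rpoly set"
  assumes qm: "quadratic_module Q" and proper: "- 1 \<notin> Q"
    and maximal: "\<And>R. quadratic_module R \<Longrightarrow> - 1 \<notin> R \<Longrightarrow> Q \<subseteq> R \<Longrightarrow> R = Q"
  shows "a \<in> Q \<or> - a \<in> Q"
proof (rule ccontr)
  have adjoin: "\<exists>b s. b \<in> Q \<and> s \<in> sos \<and> - 1 = b + s * a" if "a \<notin> Q" for a
  proof -
    let ?R = "{b + s * a | b s. b \<in> Q \<and> s \<in> sos}"
    have "b + 0 * a \<in> ?R" if "b \<in> Q" for b using that sos_0 by blast
    then have "Q \<subseteq> ?R" by auto
    moreover have "0 + 1 * a \<in> ?R" using qm_0[OF qm] sos_1 by blast
    then have "a \<in> ?R" by simp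
    ultimately have "- 1 \<in> ?R" using maximal[OF qm_adjoin[OF qm], of a] \<open>a \<notin> Q\<close> by blast
    then show ?thesis by blast
  qed
  assume "\<not> (a \<in> Q \<or> - a \<in> Q)"
  then obtain b s c t where Q: "b \<in> Q" "c \<in> Q" and s: "s \<in> sos" "t \<in> sos"
    and b: "- 1 = b + s * a" and c: "- 1 = c + t * (- a)"
    using adjoin[of a] adjoin[of "- a"] by blast
  have sa: "s * a = - 1 - b" using b by (metis add_diff_cancel_left')
  have "t * a = c - (c + t * (- a))" by simp
  also have "\<dots> = c - - 1" by (simp only: c[symmetric])
  finally have ta: "t * a = 1 + c" by simp
  \<comment> \<open>Both sides equal \<open>t * s * a\<close>, which eliminates \<open>a\<close>
    from the two representations.\<close>
  have "t * (- 1 - b) = s * (1 + c)"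
    by (simp add: sa[symmetric] ta[symmetric] algebra_simps)
  moreover have "- s - (t * b + s * c + t) = t * (- 1 - b) - s * (1 + c)"
    by (simp add: algebra_simps)
  ultimately have "- s - (t * b + s * c + t) = 0" by simp
  then have "- s = t * b + s * c + t" by simp
  also have "\<dots> \<in> Q"
    by (rule qm_add[OF qm qm_add[OF qm qm_sos_mult[OF qm s(2) Q(1)] qm_sos_mult[OF qm s(1) Q(2)]]
          qm_sos[OF qm s(2)]])
  finally have ms: "- s \<in> Q" .
  have "s * (a + 1)\<^sup>2 + (a - 1)\<^sup>2 * (- s) = pconst 4 * (s * a)"
    unfolding pconst_numeral by (rule polarization)
  moreover have "pconst (1/4) * (pconst 4 * (s * a)) = s * a"
    by (simp add: mult.assoc[symmetric] pconst_mult[symmetric])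
  ultimately have "s * a = pconst (1/4) * (s * (a + 1)\<^sup>2 + (a - 1)\<^sup>2 * (- s))"
    by (simp only:)
  also have "\<dots> \<in> Q"
    by (rule qm_scale[OF qm _ qm_add[OF qm qm_sos[OF qm sos_mult[OF s(1) sos_square]]
          qm_square_mult[OF qm ms]]]) simp
  finally have "- 1 - b \<in> Q" by (simp add: sa)
  then show False using qm_add[OF qm _ Q(1)] proper by fastforce
qed

text \<open>Modulo a total Archimedean quadratic module every polynomial is infinitesimally close to a
  unique constant; this standard part is a ring homomorphism, that is, evaluation at a point.\<close>

lemma total_qm_point:
  fixes Q :: "'v::finite rpoly set"
  assumes qm: "quadratic_module Q" and proper: "- 1 \<notin> Q" and arch: "archimedean_module Q"
    and total: "\<And>a. a \<in> Q \<or> - a \<in> Q"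
  obtains z where "\<And>a. a \<in> Q \<Longrightarrow> peval z a \<ge> 0"
proof -
  \<comment> \<open>\<open>near a c\<close> says that \<open>a\<close> and \<open>c\<close> differ
    by an infinitesimal modulo \<open>Q\<close>; the slack allows for polynomials that differ from a
    constant by a nonzero infinitesimal of either sign.\<close>
  define near where
    "near a c \<longleftrightarrow> (\<forall>\<delta>>0. a - pconst (c - \<delta>) \<in> Q \<and> pconst (c + \<delta>) - a \<in> Q)" for a c
  note pos_iff = pconst_in_proper_qm_iff[OF qm proper]
  have near_unique: "c = c'" if "near a c" "near a c'" for a c c'
  proof -
    have "c \<le> c'" if "near a c" "near a c'" for c c'
    proof (rule field_le_epsilon)
      fix e :: real assume "e > 0"
      then have "(a - pconst (c - e/2)) + (pconst (c' + e/2) - a) \<in> Q"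
        using that unfolding near_def by (intro qm_add[OF qm]) auto
      then have "pconst ((c' + e/2) - (c - e/2)) \<in> Q" by (simp only: pconst_diff) (simp add: algebra_simps)
      then show "c \<le> c' + e" by (simp add: pos_iff)
    qed
    then show ?thesis using that by (simp add: antisym)
  qed
  have near_ex: "\<exists>c. near a c" for a
  proof -
    \<comment> \<open>The constants below \<open>a\<close> form a lower cut: the Archimedean
      property makes it nonempty and bounded, and its supremum is the standard part.\<close>
    define S where "S = {r. a - pconst r \<in> Q}"
    obtain N K where N: "pconst N - a \<in> Q" and K: "pconst K - (- a) \<in> Q"
      using arch unfolding archimedean_module_def by blast
    have ne: "S \<noteq> {}" using K unfolding S_def by (auto intro!: exI[of _ "- K"] simp: pconst_uminus add.commute)
    have "r \<le> N" if "r \<in> S" for r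
    proof -
      have "(a - pconst r) + (pconst N - a) \<in> Q"
        using that N unfolding S_def by (intro qm_add[OF qm]) auto
      then have "pconst (N - r) \<in> Q" by (simp add: pconst_diff)
      then show ?thesis by (simp add: pos_iff)
    qed
    then have bdd: "bdd_above S" by (rule bdd_aboveI)
    have "near a (Sup S)" unfolding near_def
    proof (intro allI impI conjI)
      fix \<delta> :: real assume "\<delta> > 0"
      then obtain r where r: "r \<in> S" "Sup S - \<delta> < r"
        using less_cSup_iff[OF ne bdd, of "Sup S - \<delta>"] by auto
      have "(a - pconst r) + pconst (r - (Sup S - \<delta>)) \<in> Q"
        using r unfolding S_def by (intro qm_add[OF qm] qm_pconst[OF qm]) auto
      then show "a - pconst (Sup S - \<delta>) \<in> Q"
        by (simp add: pconst_diff pconst_add algebra_simps)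
      \<comment> \<open>Above the supremum, totality forces the opposite sign.\<close>
      have "Sup S + \<delta> \<notin> S" using cSup_upper[OF _ bdd, of "Sup S + \<delta>"] \<open>\<delta> > 0\<close> by auto
      then show "pconst (Sup S + \<delta>) - a \<in> Q"
        using total[of "a - pconst (Sup S + \<delta>)"] unfolding S_def by simp
    qed
    then show ?thesis ..
  qed
  have near_const: "near (pconst c) c" for c
    unfolding near_def by (simp add: pconst_diff[symmetric] pos_iff)
  have near_add: "near (a + b) (c + d)" if "near a c" "near b d" for a b c d
    unfolding near_def
  proof (intro allI impI conjI)
    fix \<delta> :: real assume \<delta>: "\<delta> > 0"
    have "(a - pconst (c - \<delta>/2)) + (b - pconst (d - \<delta>/2)) \<in> Q"
      "(pconst (c + \<delta>/2) - a) + (pconst (d + \<delta>/2) - b) \<in> Q"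
      using that \<delta> unfolding near_def by (auto intro!: qm_add[OF qm])
    moreover have "pconst (c + d - \<delta>) = pconst (c - \<delta>/2) + (pconst (d - \<delta>/2) :: 'v rpoly)"
      "pconst (c + d + \<delta>) = pconst (c + \<delta>/2) + (pconst (d + \<delta>/2) :: 'v rpoly)"
      by (simp_all add: pconst_add[symmetric] algebra_simps)
    ultimately show "a + b - pconst (c + d - \<delta>) \<in> Q" "pconst (c + d + \<delta>) - (a + b) \<in> Q"
      by (simp_all add: algebra_simps)
  qed
  have near_uminus: "near (- a) (- c)" if "near a c" for a c
    using that unfolding near_def by (auto simp: pconst_diff pconst_add pconst_uminus algebra_simps)
  have near_scale: "near (pconst k * a) (k * c)" if a: "near a c" for k a c
  proof -
    have pos: "near (pconst k * a) (k * c)" if k: "k > 0" for k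
      unfolding near_def
    proof (intro allI impI conjI)
      fix \<delta> :: real assume \<delta>: "\<delta> > 0"
      have "pconst k * (a - pconst (c - \<delta>/k)) \<in> Q" "pconst k * (pconst (c + \<delta>/k) - a) \<in> Q"
        using k \<delta> a unfolding near_def by (auto intro!: qm_scale[OF qm])
      moreover have "pconst (k * c - \<delta>) = pconst k * (pconst (c - \<delta>/k) :: 'v rpoly)"
        "pconst (k * c + \<delta>) = pconst k * (pconst (c + \<delta>/k) :: 'v rpoly)"
        using k by (simp_all add: pconst_mult[symmetric] algebra_simps)
      ultimately show "pconst k * a - pconst (k * c - \<delta>) \<in> Q" "pconst (k * c + \<delta>) - pconst k * a \<in> Q"
        by (simp_all add: algebra_simps)
    qed
    consider "k > 0" | "k = 0" | "- k > 0" by linarith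
    then show ?thesis
    proof cases
      case 2
      then show ?thesis using near_const[of 0] by simp
    next
      case 3
      then show ?thesis using near_uminus[OF pos[OF 3]] by (simp add: pconst_uminus)
    qed (rule pos)
  qed
  \<comment> \<open>Bounding \<open>e\<close> by \<open>sqrt \<delta>\<close> on both sides bounds
    its square by \<open>\<delta>\<close>.\<close>
  have near_square_0: "near (e\<^sup>2) 0" if e: "near e 0" for e
    unfolding near_def
  proof (intro allI impI conjI)
    fix \<delta> :: real assume \<delta>: "\<delta> > 0"
    have "e\<^sup>2 + pconst \<delta> \<in> Q"
      using \<delta> by (intro qm_add[OF qm] qm_sos[OF qm] sos_square qm_pconst[OF qm]) simp
    then show "e\<^sup>2 - pconst (0 - \<delta>) \<in> Q" by (simp add: pconst_uminus)
    have "pconst (sqrt \<delta>) - e \<in> Q \<and> pconst (sqrt \<delta>) + e \<in> Q"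
      using e \<delta> unfolding near_def
      by (auto simp: pconst_uminus add.commute dest!: spec[of _ "sqrt \<delta>"])
    then show "pconst (0 + \<delta>) - e\<^sup>2 \<in> Q"
      using qm_bounded_square[OF qm, of "sqrt \<delta>" e] \<delta> by simp
  qed
  have near_square: "near (a\<^sup>2) (c\<^sup>2)" if a: "near a c" for a c
  proof -
    have e: "near (a + pconst (- c)) 0"
      using near_add[OF a near_const[of "- c"]] by simp
    have "near ((a + pconst (- c))\<^sup>2 + pconst (2 * c) * a + pconst (- (c\<^sup>2))) (0 + (2 * c) * c + - (c\<^sup>2))"
      by (intro near_add near_square_0 e near_scale a near_const)
    moreover have "(a + pconst (- c))\<^sup>2 + pconst (2 * c) * a + pconst (- (c\<^sup>2)) = a\<^sup>2"
    proof -
      show ?thesis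
        by (simp add: pconst_uminus pconst_mult pconst_numeral power2_eq_square algebra_simps)
    qed
    ultimately show ?thesis by (simp add: power2_eq_square)
  qed
  have near_mult: "near (a * b) (c * d)" if "near a c" "near b d" for a b c d
  proof -
    have "near (pconst (1/2) * ((a + b)\<^sup>2 + (- (a\<^sup>2) + - (b\<^sup>2)))) ((1/2) * ((c + d)\<^sup>2 + (- (c\<^sup>2) + - (d\<^sup>2))))"
      by (intro near_scale near_add near_square near_uminus that)
    moreover have "(a + b)\<^sup>2 + (- (a\<^sup>2) + - (b\<^sup>2)) = pconst 2 * (a * b)"
    proof -
      show ?thesis by (simp add: pconst_numeral power2_eq_square algebra_simps)
    qed
    ultimately show ?thesis
      by (simp add: mult.assoc[symmetric] pconst_mult[symmetric]) (simp add: power2_eq_square algebra_simps)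
  qed
  obtain \<alpha> where \<alpha>: "near a (\<alpha> a)" for a using near_ex by metis
  \<comment> \<open>Uniqueness of the standard part turns the closure rules for \<open>near\<close>
    into homomorphism laws for \<open>\<alpha>\<close>.\<close>
  have eval: "\<alpha> a = peval (\<lambda>v. \<alpha> (pvar v)) a" for a
    by (rule ring_hom_eq_peval) (blast intro: near_unique \<alpha> near_const near_add near_mult)+
  show ?thesis
  proof (rule that)
    fix a assume "a \<in> Q"
    have "0 \<le> \<alpha> a + \<delta>" if "\<delta> > 0" for \<delta>
    proof -
      have "(pconst (\<alpha> a + \<delta>) - a) + a \<in> Q"
        using \<alpha>[of a] that \<open>a \<in> Q\<close> unfolding near_def by (intro qm_add[OF qm]) auto
      then show ?thesis by (simp add: pos_iff)
    qed
    then have "0 \<le> \<alpha> a" by (rule field_le_epsilon)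
    then show "0 \<le> peval (\<lambda>v. \<alpha> (pvar v)) a" by (simp add: eval[symmetric])
  qed
qed

text \<open>Zorn's lemma extends \<open>Q\<close> to a maximal proper module, which is total and
  inherits the Archimedean property; the point found for the extension serves for
  \<open>Q\<close>.\<close>

lemma proper_archimedean_qm_point:
  fixes Q :: "'v::finite rpoly set"
  assumes qm: "quadratic_module Q" and proper: "- 1 \<notin> Q" and arch: "archimedean_module Q"
  obtains z where "\<And>a. a \<in> Q \<Longrightarrow> peval z a \<ge> 0"
proof -
  define A where "A = {R. quadratic_module R \<and> - 1 \<notin> R \<and> Q \<subseteq> R}"
  have "\<Union>C \<in> A" if "C \<noteq> {}" "subset.chain A C" for C
  proof -
    have C: "\<And>R. R \<in> C \<Longrightarrow> quadratic_module R \<and> - 1 \<notin> R \<and> Q \<subseteq> R"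
      and chain: "\<And>R S. R \<in> C \<Longrightarrow> S \<in> C \<Longrightarrow> R \<subseteq> S \<or> S \<subseteq> R"
      using that(2) unfolding subset_chain_def A_def by blast+
    have "quadratic_module (\<Union>C)" unfolding quadratic_module_def
    proof (intro conjI allI ballI)
      show "1 \<in> \<Union>C" using C qm_1 \<open>C \<noteq> {}\<close> by blast
    next
      fix a b assume "a \<in> \<Union>C" "b \<in> \<Union>C"
      then obtain R where "R \<in> C" "a \<in> R" "b \<in> R" using chain by blast
      then show "a + b \<in> \<Union>C" using C qm_add by blast
    next
      fix r a assume "a \<in> \<Union>C"
      then show "r\<^sup>2 * a \<in> \<Union>C" using C qm_square_mult by blast
    qed
    then show ?thesis using C \<open>C \<noteq> {}\<close> unfolding A_def by blast
  qed
  moreover have "A \<noteq> {}" using qm proper unfolding A_def by blast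
  ultimately obtain R where R: "R \<in> A" "\<forall>S\<in>A. R \<subseteq> S \<longrightarrow> S = R"
    using subset_Zorn_nonempty[of A] by blast
  then have "a \<in> R \<or> - a \<in> R" for a
    by (intro maximal_qm_total) (auto simp: A_def)
  then obtain z where "\<And>a. a \<in> R \<Longrightarrow> peval z a \<ge> 0"
    using total_qm_point[of R] R(1) archimedean_module_mono[OF arch, of R] unfolding A_def by blast
  then show ?thesis using that R(1) unfolding A_def by blast
qed

text \<open>Given \<open>s f - 1 \<in> Q\<close> with \<open>s\<close> a sum of squares and \<open>k\<close> large, the left-hand side below lies in
  \<open>Q\<close> whenever \<open>f + r\<close> does and \<open>r \<ge> 0\<close>; dividing by \<open>k\<^sup>2\<close> improves \<open>r\<close> to \<open>r - 1 / k\<^sup>2\<close>.\<close>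

lemma woermann_identity:
  fixes f r s k :: "'a::comm_ring_1"
  shows "(k - s)\<^sup>2 * (f + r) + 2 * k * (s * f - 1) + r * (s * (2 * k - s)) + (2 * k - (s\<^sup>2 * f + 1))
    = k * k * (f + r) - 1"
  by (simp add: power2_eq_square algebra_simps)

text \<open>No point makes \<open>Q\<close> and \<open>- f\<close> simultaneously nonnegative, so
  adjoining \<open>- f\<close> produces \<open>- 1\<close>, which puts \<open>s * f - 1\<close> into
  \<open>Q\<close>. Starting from \<open>f\<close> plus a large constant, the identity above then
  lowers the constant by the same amount at each step until it is no longer positive.\<close>

theorem archimedean_positivstellensatz:
  fixes Q :: "'v::finite rpoly set"
  assumes qm: "quadratic_module Q" and arch: "archimedean_module Q"
    and pos: "\<And>z. (\<And>a. a \<in> Q \<Longrightarrow> peval z a \<ge> 0) \<Longrightarrow> peval z f > 0"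
  shows "f \<in> Q"
proof -
  let ?R = "{b + s * (- f) | b s. b \<in> Q \<and> s \<in> sos}"
  have QR: "b \<in> ?R" if "b \<in> Q" for b
  proof -
    have "b + 0 * (- f) \<in> ?R" using that sos_0 by blast
    then show ?thesis by simp
  qed
  have "- 1 \<in> ?R"
  proof (rule ccontr)
    assume "- 1 \<notin> ?R"
    then obtain z where z: "\<And>a. a \<in> ?R \<Longrightarrow> peval z a \<ge> 0"
      using proper_archimedean_qm_point[of ?R] qm_adjoin[OF qm] archimedean_module_mono[OF arch, of ?R] QR
      by blast
    then have "peval z f > 0" using pos QR by blast
    moreover have "0 + 1 * (- f) \<in> ?R" using qm_0[OF qm] sos_1 by blast
    then have "peval z (- f) \<ge> 0" using z by fastforce
    ultimately show False by (simp add: peval_uminus)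
  qed
  then obtain b s where b: "b \<in> Q" and s: "s \<in> sos" and eq: "- 1 = b + s * (- f)" by blast
  have sf: "s * f - 1 \<in> Q" using b eq by (simp add: algebra_simps)
  \<comment> \<open>\<open>N1\<close> and \<open>N2\<close> control the two remainder terms of the
    identity once \<open>k\<close> is large; \<open>N3\<close> supplies the constant at which the
    descent starts.\<close>
  obtain N1 N2 N3 where N: "pconst N1 - s \<in> Q" "pconst N2 - (s\<^sup>2 * f + 1) \<in> Q" "pconst N3 - (- f) \<in> Q"
    using arch unfolding archimedean_module_def by blast
  define k where "k = max 1 (max N1 N2)"
  have k: "k > 0" "N1 \<le> 2 * k" "N2 \<le> 2 * k" by (auto simp: k_def)
  have pconst_mono: "pconst M' - a \<in> Q" if "pconst M - a \<in> Q" "M \<le> M'" for a M M'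
  proof -
    have "pconst (M' - M) + (pconst M - a) \<in> Q"
      using that by (intro qm_add[OF qm] qm_pconst[OF qm]) auto
    then show ?thesis by (simp add: pconst_diff)
  qed
  have 2: "pconst (2 * k) = 2 * (pconst k :: 'v rpoly)"
    by (simp add: pconst_mult pconst_numeral)
  have step: "f + pconst (r - 1 / k\<^sup>2) \<in> Q" if r: "f + pconst r \<in> Q" "r \<ge> 0" for r
  proof -
    have "(pconst k - s)\<^sup>2 * (f + pconst r) \<in> Q"
      by (rule qm_square_mult[OF qm r(1)])
    moreover have "pconst (2 * k) * (s * f - 1) \<in> Q"
      by (rule qm_scale[OF qm _ sf]) (use k in simp)
    moreover have "pconst r * (s * (pconst (2 * k) - s)) \<in> Q"
      by (intro qm_scale[OF qm r(2)] qm_sos_mult[OF qm s] pconst_mono[OF N(1)] k)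
    moreover have "pconst (2 * k) - (s\<^sup>2 * f + 1) \<in> Q"
      by (intro pconst_mono[OF N(2)] k)
    ultimately have "(pconst k - s)\<^sup>2 * (f + pconst r) + pconst (2 * k) * (s * f - 1)
        + pconst r * (s * (pconst (2 * k) - s)) + (pconst (2 * k) - (s\<^sup>2 * f + 1)) \<in> Q"
      by (intro qm_add[OF qm])
    then have "pconst k * pconst k * (f + pconst r) - 1 \<in> Q"
      unfolding 2 woermann_identity .
    also have "pconst k * pconst k * (f + pconst r) - 1 = pconst (k\<^sup>2) * (f + pconst (r - 1 / k\<^sup>2))"
    proof -
      have "pconst (k\<^sup>2) * pconst (1 / k\<^sup>2) = (1 :: 'v rpoly)"
        using k by (simp add: pconst_mult[symmetric])
      then have "pconst (k\<^sup>2) * (f + (pconst r - pconst (1 / k\<^sup>2))) = pconst (k\<^sup>2) * (f + pconst r) - 1"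
        by (simp only: distrib_left right_diff_distrib) simp
      then show ?thesis
        by (simp only: pconst_diff) (simp only: power2_eq_square pconst_mult)
    qed
    finally show ?thesis using qm_scale_cancel[OF qm, of "k\<^sup>2"] k by simp
  qed
  have drop: "f \<in> Q" if "f + pconst r \<in> Q" "r \<le> 0" for r
    using qm_add[OF qm that(1) qm_pconst[OF qm, of "- r"]] that(2) by (simp add: pconst_uminus)
  \<comment> \<open>The alternative \<open>f \<in> Q\<close> takes over once the constant has become
    negative, where \<open>step\<close> no longer applies.\<close>
  have iterate: "f + pconst (max 0 N3 - real n / k\<^sup>2) \<in> Q \<or> f \<in> Q" for n
  proof (induction n)
    case 0
    have "pconst (max 0 N3) - (- f) \<in> Q" using pconst_mono[OF N(3)] by simp
    then show ?case by (simp add: add.commute)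
  next
    case (Suc n)
    let ?r = "max 0 N3 - real n / k\<^sup>2"
    have r: "max 0 N3 - real (Suc n) / k\<^sup>2 = ?r - 1 / k\<^sup>2" by (simp add: add_divide_distrib)
    show ?case unfolding r
      using Suc step[of ?r] drop[of ?r] linear[of 0 ?r] by blast
  qed
  obtain n where "max 0 N3 * k\<^sup>2 < real n" using reals_Archimedean2 by blast
  then have "max 0 N3 - real n / k\<^sup>2 < 0" using k by (simp add: field_simps)
  then show ?thesis using iterate[of n] drop by force
qed

lemma quadratic_module_generated:
  "quadratic_module {s0 + (\<Sum>i\<in>I. s i * q i) | s0 s. s0 \<in> sos \<and> (\<forall>i\<in>I. s i \<in> sos)}"
  (is "quadratic_module ?Q")
  unfolding quadratic_module_def
proof (intro conjI ballI allI)
  have "1 + (\<Sum>i\<in>I. 0 * q i) \<in> ?Q"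
    by (intro CollectI exI[of _ 1] exI[of _ "\<lambda>i. 0"]) auto
  then show "1 \<in> ?Q" by simp
next
  fix a b assume "a \<in> ?Q" "b \<in> ?Q"
  then obtain s0 s t0 t where "s0 \<in> sos" "\<forall>i\<in>I. s i \<in> sos" "t0 \<in> sos" "\<forall>i\<in>I. t i \<in> sos"
    and ab: "a = s0 + (\<Sum>i\<in>I. s i * q i)" "b = t0 + (\<Sum>i\<in>I. t i * q i)" by blast
  then have "(s0 + t0) + (\<Sum>i\<in>I. (s i + t i) * q i) \<in> ?Q"
    by (intro CollectI exI[of _ "s0 + t0"] exI[of _ "\<lambda>i. s i + t i"]) (auto intro: sos_add)
  then show "a + b \<in> ?Q" by (simp add: ab distrib_right sum.distrib algebra_simps)
next
  fix r a assume "a \<in> ?Q"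
  then obtain s0 s where "s0 \<in> sos" "\<forall>i\<in>I. s i \<in> sos" and a: "a = s0 + (\<Sum>i\<in>I. s i * q i)" by blast
  then have "r\<^sup>2 * s0 + (\<Sum>i\<in>I. (r\<^sup>2 * s i) * q i) \<in> ?Q"
    by (intro CollectI exI[of _ "r\<^sup>2 * s0"] exI[of _ "\<lambda>i. r\<^sup>2 * s i"]) (auto intro: sos_square_mult)
  then show "r\<^sup>2 * a \<in> ?Q" by (simp add: a distrib_left sum_distrib_left mult.assoc)
qed

text \<open>The representations form an Archimedean quadratic module containing every
  \<open>q i\<close>, so a point where the module is nonnegative satisfies all the
  constraints.\<close>

theorem putinar_positivstellensatz:
  fixes q :: "'i \<Rightarrow> 'v::finite rpoly"
  assumes fin: "finite I" and arch: "archimedean_family I q"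
    and pos: "\<And>z. (\<And>i. i \<in> I \<Longrightarrow> peval z (q i) \<ge> 0) \<Longrightarrow> peval z f > 0"
  obtains s0 s where "s0 \<in> sos" "\<And>i. i \<in> I \<Longrightarrow> s i \<in> sos" "f = s0 + (\<Sum>i\<in>I. s i * q i)"
proof -
  define Q where "Q = {s0 + (\<Sum>i\<in>I. s i * q i) | s0 s. s0 \<in> sos \<and> (\<forall>i\<in>I. s i \<in> sos)}"
  have qm: "quadratic_module Q" unfolding Q_def by (rule quadratic_module_generated)
  have q: "q j \<in> Q" if "j \<in> I" for j
  proof -
    have "(\<Sum>i\<in>I. (if i = j then 1 else 0) * q i) = (\<Sum>i\<in>I. if i = j then q i else 0)"
      by (rule sum.cong) auto
    also have "\<dots> = q j" using that fin by simp
    finally show ?thesis unfolding Q_def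
      by (intro CollectI exI[of _ 0] exI[of _ "\<lambda>i. if i = j then 1 else 0"]) auto
  qed
  have "archimedean_module Q"
  proof -
    obtain M where "pconst M - (\<Sum>v\<in>UNIV. (pvar v)\<^sup>2) \<in> Q"
      using arch unfolding archimedean_family_def Q_def by blast
    then show ?thesis by (rule archimedean_moduleI[OF qm])
  qed
  then have "f \<in> Q"
    by (rule archimedean_positivstellensatz[OF qm]) (auto intro: pos q)
  then show ?thesis using that unfolding Q_def by blast
qed

subsection \<open>Polynomial functions and the uniform measure\<close>

lemma continuous_on_peval [continuous_intros]:
  assumes "\<And>v. continuous_on S (\<lambda>x. z x v)"
  shows "continuous_on S (\<lambda>x. peval (z x) q)"
  unfolding peval_def by (intro continuous_intros assms)

lemma continuous_on_evalx: "continuous_on S (evalx q)"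
  unfolding evalx_def[abs_def] by (intro continuous_intros)

lemma continuous_on_evalxy: "continuous_on S (\<lambda>z. evalxy q (fst z) (snd z))"
proof -
  have "continuous_on S (\<lambda>z. case_sum (\<lambda>i. fst z $ i) (\<lambda>k. snd z $ k) v)"
    for S :: "((real ^ 'a) \<times> (real ^ 'b)) set" and v
    by (cases v) (auto intro!: continuous_intros)
  then show ?thesis
    unfolding evalxy_def by (intro continuous_intros)
qed

lemma evalxy_incl_x:
  fixes q :: "'n::finite rpoly" and y :: "real ^ 'p::finite"
  shows "evalxy (incl_x q) x y = evalx q x"
proof -
  have "evalxy (Poly_Mapping.single (\<Sum>i\<in>Poly_Mapping.keys a. Poly_Mapping.single (Inl i) (Poly_Mapping.lookup a i)) c) x y
      = c * (\<Prod>i\<in>UNIV. (x $ i) ^ Poly_Mapping.lookup a i)" for a c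
  proof -
    let ?b = "\<Sum>i\<in>Poly_Mapping.keys a. Poly_Mapping.single (Inl i :: 'n + 'p) (Poly_Mapping.lookup a i)"
    have Inl: "Poly_Mapping.lookup ?b (Inl i) = Poly_Mapping.lookup a i" for i
      by (simp add: lookup_sum lookup_single when_def in_keys_iff)
    have Inr: "Poly_Mapping.lookup ?b (Inr k) = 0" for k
      by (simp add: lookup_sum lookup_single when_def)
    show ?thesis
      by (simp add: evalxy_def peval_single UNIV_Plus_UNIV[symmetric] prod.Plus Inl Inr
          del: UNIV_Plus_UNIV)
  qed
  then show ?thesis
    unfolding incl_x_def by (simp add: evalxy_def peval_sum)
      (simp add: evalx_def peval_def prod_power_keys)
qed

text \<open>Bridges the analytic notion of polynomial function, for which Stone-Weierstrass is
  available, and formal polynomials. A linear map is expanded in the standard basis.\<close>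

lemma real_polynomial_function_evalx:
  fixes f :: "real ^ 'n::finite \<Rightarrow> real"
  assumes "real_polynomial_function f"
  shows "\<exists>q. \<forall>x. evalx q x = f x"
  using assms
proof induction
  case (linear f)
  have "f x = evalx (\<Sum>i\<in>UNIV. pconst (f (axis i 1)) * pvar i) x" for x
  proof -
    interpret bounded_linear f by (rule linear)
    have "f x = f (\<Sum>i\<in>UNIV. (x $ i) *\<^sub>R axis i 1)"
      using basis_expansion[of x] by (simp add: scalar_mult_eq_scaleR)
    then show ?thesis by (simp add: evalx_def peval_simps sum scaleR mult.commute)
  qed
  then show ?case by metis
next
  case (const c)
  show ?case by (rule exI[of _ "pconst c"]) (simp add: evalx_def)
next
  case (add f g)
  then show ?case by (metis evalx_def peval_add)
next
  case (mult f g)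
  then show ?case by (metis evalx_def peval_mult)
qed

lemma polynomial_approximation:
  fixes f :: "real ^ 'n::finite \<Rightarrow> real"
  assumes "compact S" "continuous_on S f" "0 < e"
  obtains q where "\<And>x. x \<in> S \<Longrightarrow> \<bar>f x - evalx q x\<bar> < e"
  using Stone_Weierstrass_real_polynomial_function[OF assms] real_polynomial_function_evalx by metis

section \<open>The uniform probability measure on the cube\<close>

lemma Bset_eq_cbox: "(Bset :: (real ^ 'n::finite) set) = cbox (\<chi> i. - 1) (\<chi> i. 1)"
  by (auto simp: Bset_def mem_box_cart)

lemma compact_Bset: "compact (Bset :: (real ^ 'n::finite) set)"
  unfolding Bset_eq_cbox by (rule compact_cbox)

lemma Bset_sets [measurable]: "(Bset :: (real ^ 'n::finite) set) \<in> sets borel"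
  unfolding Bset_eq_cbox by simp

lemma emeasure_open_pos:
  fixes U :: "'a::euclidean_space set"
  assumes "open U" "U \<noteq> {}"
  shows "emeasure lborel U > 0"
proof -
  obtain z r where r: "r > 0" "ball z r \<subseteq> U"
    using assms by (meson ex_in_conv openE)
  have "0 < emeasure lborel (ball z r)"
    using r by (simp add: emeasure_ball unit_ball_vol_pos)
  also have "\<dots> \<le> emeasure lborel U"
    using r assms by (intro emeasure_mono) auto
  finally show ?thesis .
qed

lemma emeasure_Bset: "emeasure lborel (Bset :: (real ^ 'n::finite) set) \<noteq> 0"
  "emeasure lborel (Bset :: (real ^ 'n::finite) set) \<noteq> \<infinity>"
proof -
  have "ball 0 1 \<subseteq> (Bset :: (real ^ 'n) set)"
  proof
    fix x :: "real ^ 'n" assume "x \<in> ball 0 1"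
    then have "\<bar>x $ i\<bar> \<le> 1" for i using component_le_norm_cart[of x i] by simp
    then show "x \<in> Bset" by (simp add: Bset_def abs_le_iff minus_le_iff)
  qed
  then have "emeasure lborel (ball (0 :: real ^ 'n) 1) \<le> emeasure lborel (Bset :: (real ^ 'n) set)"
    by (intro emeasure_mono) auto
  moreover have "emeasure lborel (ball (0 :: real ^ 'n) 1) > 0"
    by (rule emeasure_open_pos) auto
  ultimately show "emeasure lborel (Bset :: (real ^ 'n) set) \<noteq> 0" by auto
  show "emeasure lborel (Bset :: (real ^ 'n) set) \<noteq> \<infinity>"
    unfolding Bset_eq_cbox by (simp add: emeasure_lborel_cbox_eq)
qed

lemma prob_space_mu: "prob_space (mu :: (real ^ 'n::finite) measure)"
  unfolding mu_def by (rule prob_space_uniform_measure) (use emeasure_Bset in auto)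

lemma sets_mu [measurable_cong, simp]: "sets (mu :: (real ^ 'n::finite) measure) = sets borel"
  by (simp add: mu_def)

lemma AE_mu: "AE x in mu. x \<in> (Bset :: (real ^ 'n::finite) set)"
  unfolding mu_def by (rule AE_uniform_measureI) auto

lemma integrable_mu:
  fixes f :: "real ^ 'n::finite \<Rightarrow> real"
  assumes f: "continuous_on UNIV f"
  shows "integrable mu f"
proof -
  interpret prob_space "mu :: (real ^ 'n) measure" by (rule prob_space_mu)
  have "bounded (f ` Bset)"
    using compact_continuous_image[OF continuous_on_subset[OF f] compact_Bset] compact_imp_bounded by blast
  then obtain C where "\<And>x. x \<in> Bset \<Longrightarrow> norm (f x) \<le> C" by (auto simp: bounded_iff)
  then have "AE x in mu. norm (f x) \<le> C" using AE_mu by (auto elim: eventually_mono)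
  moreover have "f \<in> borel_measurable mu"
    using borel_measurable_continuous_onI[OF f] by simp
  ultimately show ?thesis by (rule integrable_const_bound)
qed

lemma integral_mu_mono:
  fixes f g :: "real ^ 'n::finite \<Rightarrow> real"
  assumes "continuous_on UNIV f" "continuous_on UNIV g" "\<And>x. x \<in> Bset \<Longrightarrow> f x \<le> g x"
  shows "(\<integral>x. f x \<partial>mu) \<le> (\<integral>x. g x \<partial>mu)"
  by (rule integral_mono_AE) (use assms AE_mu in \<open>auto intro: integrable_mu elim: eventually_mono\<close>)

text \<open>A vanishing integral would make \<open>f\<close> vanish almost everywhere, hence make
  \<open>U\<close> a null set, although a nonempty open set has positive volume.\<close>

lemma integral_mu_pos:
  fixes f :: "real ^ 'n::finite \<Rightarrow> real"
  assumes f: "continuous_on UNIV f" "\<And>x. f x \<ge> 0"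
    and U: "open U" "U \<noteq> {}" "U \<subseteq> Bset" "\<And>x. x \<in> U \<Longrightarrow> f x > 0"
  shows "(\<integral>x. f x \<partial>mu) > 0"
proof (rule ccontr)
  assume "\<not> (\<integral>x. f x \<partial>mu) > 0"
  then have "(\<integral>x. f x \<partial>mu) = 0" using f(2) by (simp add: antisym not_less)
  then have "AE x in mu. f x = 0"
    using integral_nonneg_eq_0_iff_AE[OF integrable_mu[OF f(1)]] f(2) by auto
  then have "AE x in mu. x \<notin> U" by (rule eventually_mono) (use U(4) in force)
  moreover have "U \<in> sets mu" using U(1) by simp
  ultimately have "emeasure mu U = 0"
    by (simp add: AE_iff_measurable[where N = U] sets_eq_imp_space_eq[OF sets_mu])
  moreover have "emeasure mu U = emeasure lborel U / emeasure lborel (Bset :: (real ^ 'n) set)"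
    unfolding mu_def using U by (subst emeasure_uniform_measure) (auto simp: Int_absorb1)
  ultimately show False
    using emeasure_open_pos[OF U(1,2)] emeasure_Bset(2) by (auto simp: ennreal_divide_eq_0_iff)
qed

subsection \<open>The hierarchy of semidefinite programs\<close>

lemma peval_eq_evalxy:
  "peval z q = evalxy q (\<chi> i. z (Inl i)) (\<chi> k. z (Inr k))"
proof -
  have "case_sum (\<lambda>i. z (Inl i)) (\<lambda>k. z (Inr k)) = z"
    by (auto split: sum.split)
  then show ?thesis by (simp add: evalxy_def)
qed

lemma evalxy_theta: "evalxy (theta i) x y = 1 - (x $ i)\<^sup>2"
  by (simp add: theta_def evalxy_def peval_simps)

lemma mem_Bset_iff: "x \<in> Bset \<longleftrightarrow> (\<forall>i. 1 - (x $ i)\<^sup>2 \<ge> 0)"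
  by (auto simp: Bset_def abs_square_le_1 abs_le_iff minus_le_iff)

lemma mem_Kset_iff: "(x, y) \<in> Kset m h \<longleftrightarrow> x \<in> Bset \<and> y \<in> Yset m h x"
  by (simp add: Kset_def Yset_def)

lemma opt_sol_opt_val:
  assumes "opt_sol f S z"
  shows "z \<in> S" "opt_val f S = ereal (evalx f z)"
proof -
  show z: "z \<in> S" using assms by (simp add: opt_sol_def is_arg_min_def)
  show "opt_val f S = ereal (evalx f z)"
    unfolding opt_val_def using assms z
    by (intro antisym INF_greatest INF_lower2[OF z])
      (auto simp: opt_sol_def is_arg_min_def not_less)
qed

lemma opt_sol_exists:
  assumes "compact S" "S \<noteq> {}"
  shows "\<exists>z. opt_sol f S z"
  using continuous_attains_inf[OF assms continuous_on_evalx[of S f]]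
  by (auto simp: opt_sol_def is_arg_min_def not_less)

text \<open>Every product in the certificate is nonnegative on \<open>Kset m h\<close>; so a
  feasible \<open>q\<close> bounds \<open>g\<close> from above on each fibre over the cube.\<close>

lemma sdp_feasible_imp_ge:
  assumes feas: "sdp_feasible m h g d q \<sigma> \<psi>" and h0: "h 0 = 1" and K: "(x, y) \<in> Kset m h"
  shows "evalxy g x y \<le> evalx q x"
proof -
  have h: "evalxy (h j) x y \<ge> 0" if "j \<in> {0..m}" for j
    using K that by (cases "j = 0") (auto simp: Kset_def h0 evalxy_def)
  have \<theta>: "evalxy (theta i) x y \<ge> 0" for i
    using K by (simp add: mem_Kset_iff mem_Bset_iff evalxy_theta)
  have \<sigma>: "evalxy (\<sigma> j) x y \<ge> 0" if "j \<in> {0..m}" for j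
    using feas that unfolding sdp_feasible_def evalxy_def by (auto intro: peval_sos_nonneg)
  have \<psi>: "evalxy (\<psi> i) x y \<ge> 0" for i
    using feas unfolding sdp_feasible_def evalxy_def by (auto intro: peval_sos_nonneg)
  have "evalx q x - evalxy g x y = evalxy (incl_x q - g) x y"
    by (simp add: evalxy_incl_x[symmetric, of q x y]) (simp add: evalxy_def peval_simps)
  also have "\<dots> = evalxy ((\<Sum>j=0..m. \<sigma> j * h j) + (\<Sum>i\<in>UNIV. \<psi> i * theta i)) x y"
    using feas by (simp add: sdp_feasible_def)
  also have "\<dots> = (\<Sum>j=0..m. evalxy (\<sigma> j) x y * evalxy (h j) x y)
      + (\<Sum>i\<in>UNIV. evalxy (\<psi> i) x y * evalxy (theta i) x y)"
    by (simp add: evalxy_def peval_simps)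
  also have "\<dots> \<ge> 0"
    by (intro add_nonneg_nonneg sum_nonneg mult_nonneg_nonneg h \<theta> \<sigma> \<psi>)
  finally show ?thesis by simp
qed

text \<open>\<open>Kset m h\<close> is exactly the set cut out by the family in \<open>arch\<close>,
  so Putinar's theorem applies. It gives no degree bound in advance, but one certificate stays
  feasible at every level beyond its own degree.\<close>

lemma sdp_feasible_eventually:
  fixes g :: "('n::finite + 'p::finite) rpoly"
  assumes h0: "h 0 = 1"
    and arch: "archimedean_family ({1..m} <+> (UNIV :: 'n set)) (case_sum h theta)"
    and pos: "\<And>x y. (x, y) \<in> Kset m h \<Longrightarrow> evalxy g x y < evalx q x"
  shows "\<exists>D. \<forall>d\<ge>D. \<exists>\<sigma> \<psi>. sdp_feasible m h g d q \<sigma> \<psi>"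
proof -
  have "peval z (incl_x q - g) > 0"
    if z: "\<And>i. i \<in> {1..m} <+> UNIV \<Longrightarrow> peval z (case_sum h theta i) \<ge> 0" for z
  proof -
    let ?x = "\<chi> i. z (Inl i)" and ?y = "\<chi> k. z (Inr k)"
    have "evalxy (h j) ?x ?y \<ge> 0" if "j \<in> {1..m}" for j
      using z[OF InlI[OF that]] by (simp add: peval_eq_evalxy)
    moreover have "?x \<in> Bset"
      using z[OF InrI[OF UNIV_I]] unfolding mem_Bset_iff by (simp add: peval_eq_evalxy evalxy_theta)
    ultimately have "(?x, ?y) \<in> Kset m h" by (simp add: Kset_def)
    from pos[OF this] show ?thesis
      by (simp add: peval_diff) (simp add: peval_eq_evalxy evalxy_incl_x)
  qed
  then obtain s0 s where s0: "s0 \<in> sos" and s: "\<And>i. i \<in> {1..m} <+> UNIV \<Longrightarrow> s i \<in> sos"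
    and eq: "incl_x q - g = s0 + (\<Sum>i\<in>{1..m} <+> UNIV. s i * case_sum h theta i)"
    using putinar_positivstellensatz[OF _ arch, of "incl_x q - g"] by (auto simp del: UNIV_Plus_UNIV)
  \<comment> \<open>The free sum of squares \<open>s0\<close> becomes the multiplier of
    \<open>h 0 = 1\<close>.\<close>
  define \<sigma> where "\<sigma> j = (if j = 0 then s0 else s (Inl j))" for j
  define \<psi> where "\<psi> i = s (Inr i)" for i
  have "(\<Sum>j=0..m. \<sigma> j * h j) = s0 + (\<Sum>j=1..m. s (Inl j) * h j)"
    by (simp add: sum.atLeast_Suc_atMost \<sigma>_def h0)
  then have decomp: "incl_x q - g = (\<Sum>j=0..m. \<sigma> j * h j) + (\<Sum>i\<in>UNIV. \<psi> i * theta i)"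
    by (simp add: eq sum.Plus \<psi>_def)
  have \<sigma>: "\<sigma> j \<in> sos" if "j \<in> {0..m}" for j using s0 s[OF InlI, of j] that by (auto simp: \<sigma>_def)
  have \<psi>: "\<psi> i \<in> sos" for i using s[OF InrI] by (auto simp: \<psi>_def)
  let ?D = "tdegree q + (\<Sum>j=0..m. tdegree (\<sigma> j * h j)) + (\<Sum>i\<in>UNIV. tdegree (\<psi> i * theta i))"
  have "tdegree (\<sigma> j * h j) \<le> ?D" if "j \<in> {0..m}" for j
    using member_le_sum[of j "{0..m}" "\<lambda>j. tdegree (\<sigma> j * h j)"] that by simp
  moreover have "tdegree (\<psi> i * theta i) \<le> ?D" for i
    using member_le_sum[of i UNIV "\<lambda>i. tdegree (\<psi> i * theta i)"] by simp
  ultimately have "sdp_feasible m h g d q \<sigma> \<psi>" if "d \<ge> ?D" for d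
    unfolding sdp_feasible_def using decomp \<sigma> \<psi> that by (fastforce intro: order_trans)
  then show ?thesis by blast
qed

lemma near_infimum_exists:
  fixes F :: "'a \<Rightarrow> real"
  assumes "A \<noteq> {}" "\<And>a. a \<in> A \<Longrightarrow> C \<le> F a" "0 < \<delta>"
  obtains a where "a \<in> A" "\<And>b. b \<in> A \<Longrightarrow> F a < F b + \<delta>"
proof -
  have bdd: "bdd_below (F ` A)" using assms(2) by (auto intro!: bdd_belowI[of _ C])
  have "Inf (F ` A) < Inf (F ` A) + \<delta>" using assms(3) by simp
  then obtain a where "a \<in> A" "F a < Inf (F ` A) + \<delta>"
    using cInf_lessD[of "F ` A"] assms(1) by blast
  moreover have "Inf (F ` A) \<le> F b" if "b \<in> A" for b using bdd that by (rule cINF_lower)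
  ultimately show ?thesis using that by (meson add_right_mono less_le_trans)
qed

lemma sdp_optimal_small_somewhere:
  fixes g :: "('n::finite + 'p::finite) rpoly"
  assumes h0: "h 0 = 1"
    and K_compact: "compact (Kset m h)"
    and arch: "archimedean_family ({1..m} <+> (UNIV :: 'n set)) (case_sum h theta)"
    and Y_nonempty: "\<forall>x\<in>Bset. Yset m h x \<noteq> {}"
    and U: "open U" "U \<noteq> {}" "U \<subseteq> Bset"
    and g_le: "\<And>x y. x \<in> U \<Longrightarrow> y \<in> Yset m h x \<Longrightarrow> evalxy g x y \<le> c"
    and c: "c < e"
  shows "\<exists>d0. \<forall>d\<ge>d0. \<forall>q. sdp_optimal m h g d q \<longrightarrow> (\<exists>x\<in>U. evalx q x \<le> e)"
proof -
  interpret prob_space "mu :: (real ^ 'n) measure" by (rule prob_space_mu)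
  \<comment> \<open>The midpoint leaves room on both sides: \<open>c < c'\<close> keeps the lowered
    function above \<open>g\<close>, and \<open>c' < e\<close> makes the lowering gain
    something.\<close>
  define c' where "c' = (c + e) / 2"
  have c': "c < c'" "c' < e" using c by (simp_all add: c'_def)
  obtain z r where r: "r > 0" "ball z r \<subseteq> U" using U by (meson ex_in_conv openE)
  define \<phi> where "\<phi> x = max 0 (1 - dist x z / r)" for x
  have \<phi>_cont: "continuous_on UNIV \<phi>"
    unfolding \<phi>_def using r by (intro continuous_intros) auto
  have \<phi>: "0 \<le> \<phi> x" "\<phi> x \<le> 1" for x using r by (auto simp: \<phi>_def)
  have \<phi>_out: "\<phi> x = 0" if "x \<notin> U" for x
  proof -
    have "x \<notin> ball z r" using that r by blast
    then have "r \<le> dist x z" by (simp add: dist_commute not_less)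
    then show ?thesis using r by (simp add: \<phi>_def)
  qed
  have \<phi>_pos: "(\<integral>x. \<phi> x \<partial>mu) > 0"
  proof (rule integral_mu_pos[OF \<phi>_cont \<phi>(1)])
    show "open (ball z r)" "ball z r \<noteq> {}" "ball z r \<subseteq> Bset" using r U by auto
    show "\<phi> x > 0" if "x \<in> ball z r" for x
      using that r by (simp add: \<phi>_def dist_commute less_max_iff_disj)
  qed
  \<comment> \<open>A lower bound for the integral saved by the lowering; it depends neither on the
    level nor on the optimal polynomial.\<close>
  define \<delta> where "\<delta> = (e - c') * (\<integral>x. \<phi> x \<partial>mu)"
  have \<delta>: "\<delta> > 0" using \<phi>_pos c' by (simp add: \<delta>_def)
  define A where "A = {q. \<forall>(x, y)\<in>Kset m h. evalxy g x y < evalx q x}"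
  have "compact ((\<lambda>z. evalxy g (fst z) (snd z)) ` Kset m h)"
    by (rule compact_continuous_image[OF continuous_on_evalxy K_compact])
  then obtain C where C: "\<And>x y. (x, y) \<in> Kset m h \<Longrightarrow> \<bar>evalxy g x y\<bar> \<le> C"
    using compact_imp_bounded by (fastforce simp: bounded_iff)
  have "pconst (C + 1) \<in> A"
    unfolding A_def using C by (force simp: evalx_def)
  then have A_ne: "A \<noteq> {}" by blast
  have A_bdd: "- C \<le> (\<integral>x. evalx q x \<partial>mu)" if q: "q \<in> A" for q
  proof -
    have "- C \<le> evalx q x" if x: "x \<in> Bset" for x
    proof -
      obtain y where "y \<in> Yset m h x" using Y_nonempty x by blast
      then have K: "(x, y) \<in> Kset m h" using x by (simp add: mem_Kset_iff)
      then have "evalxy g x y < evalx q x" using q by (auto simp: A_def)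
      then show ?thesis using C[OF K] by simp
    qed
    then have "(\<integral>x. - C \<partial>(mu :: (real ^ 'n) measure)) \<le> (\<integral>x. evalx q x \<partial>mu)"
      by (intro integral_mu_mono continuous_on_evalx continuous_on_const)
    then show ?thesis by (simp add: prob_space)
  qed
  have "0 < \<delta> / 4" using \<delta> by simp
  \<comment> \<open>\<open>q0\<close> is chosen before the level \<open>d\<close>, so a single
    threshold \<open>D\<close> suffices for all later optimal polynomials.\<close>
  obtain q0 where q0: "q0 \<in> A"
    and q0_min: "\<And>q. q \<in> A \<Longrightarrow> (\<integral>x. evalx q0 x \<partial>mu) < (\<integral>x. evalx q x \<partial>mu) + \<delta> / 4"
    using near_infimum_exists[where F = "\<lambda>q. \<integral>x. evalx q x \<partial>mu", OF A_ne A_bdd \<open>0 < \<delta> / 4\<close>] by blast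
  obtain D where D: "\<And>d. d \<ge> D \<Longrightarrow> \<exists>\<sigma> \<psi>. sdp_feasible m h g d q0 \<sigma> \<psi>"
    using sdp_feasible_eventually[OF h0 arch, of g q0] q0 unfolding A_def by blast
  have "\<exists>x\<in>U. evalx q x \<le> e" if d: "d \<ge> D" and q: "sdp_optimal m h g d q" for d q
  proof (rule ccontr)
    assume "\<not> (\<exists>x\<in>U. evalx q x \<le> e)"
    then have q_gt: "evalx q x > e" if "x \<in> U" for x using that by force
    have q_ge: "evalxy g x y \<le> evalx q x" if "(x, y) \<in> Kset m h" for x y
      using q sdp_feasible_imp_ge[OF _ h0 that] unfolding sdp_optimal_def by blast
    define F where "F x = (1 - \<phi> x) * evalx q x + \<phi> x * c'" for x
    have F_cont: "continuous_on S F" for S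
      unfolding F_def by (intro continuous_intros continuous_on_subset[OF \<phi>_cont] continuous_on_evalx) auto
    have F_ge: "evalxy g x y \<le> F x" if K: "(x, y) \<in> Kset m h" for x y
    proof (cases "x \<in> U")
      case True
      then have "evalxy g x y \<le> c'" using g_le[of x y] K c' by (simp add: mem_Kset_iff)
      then have "(1 - \<phi> x) * evalxy g x y + \<phi> x * evalxy g x y \<le> F x"
        unfolding F_def using q_ge[OF K] \<phi>[of x] by (intro add_mono mult_left_mono) auto
      then show ?thesis by (simp add: algebra_simps)
    next
      case False
      then show ?thesis using q_ge[OF K] by (simp add: F_def \<phi>_out)
    qed
    have F_le: "F x \<le> evalx q x - (e - c') * \<phi> x" for x
    proof (cases "x \<in> U")
      case True
      then have "\<phi> x * e \<le> \<phi> x * evalx q x" using q_gt[of x] \<phi>(1)[of x] by (intro mult_left_mono) auto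
      then show ?thesis by (simp add: F_def algebra_simps)
    qed (simp add: F_def \<phi>_out)
    \<comment> \<open>Shifting by \<open>\<delta> / 8\<close> and approximating within
      \<open>\<delta> / 8\<close> keeps \<open>w\<close> strictly above \<open>F\<close> and less
      than \<open>\<delta> / 4\<close> above it.\<close>
    have "continuous_on Bset (\<lambda>x. F x + \<delta> / 8)" by (intro continuous_intros F_cont)
    then obtain w where w: "\<And>x. x \<in> Bset \<Longrightarrow> \<bar>F x + \<delta> / 8 - evalx w x\<bar> < \<delta> / 8"
      using polynomial_approximation[OF compact_Bset, of "\<lambda>x. F x + \<delta> / 8" "\<delta> / 8"] \<delta> by auto
    have w_bounds: "F x < evalx w x" "evalx w x \<le> evalx q x - (e - c') * \<phi> x + \<delta> / 4" if "x \<in> Bset" for x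
      using w[OF that] F_le[of x] by linarith+
    have "w \<in> A"
      unfolding A_def using F_ge w_bounds(1) by (fastforce simp: mem_Kset_iff intro: le_less_trans)
    \<comment> \<open>The errors add up to \<open>\<delta> / 2\<close>, less than the saving
      \<open>\<delta>\<close>; optimality of \<open>q\<close> against the feasible \<open>q0\<close>
      closes the circle.\<close>
    then have "(\<integral>x. evalx q0 x \<partial>mu) < (\<integral>x. evalx w x \<partial>mu) + \<delta> / 4" by (rule q0_min)
    also have "(\<integral>x. evalx w x \<partial>mu) \<le> (\<integral>x. evalx q x - (e - c') * \<phi> x + \<delta> / 4 \<partial>mu)"
      by (intro integral_mu_mono continuous_on_evalx continuous_intros \<phi>_cont w_bounds)
    also have "\<dots> = (\<integral>x. evalx q x \<partial>mu) - \<delta> + \<delta> / 4"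
      using integrable_mu[OF continuous_on_evalx[of UNIV q]] integrable_mu[OF \<phi>_cont]
      by (simp add: \<delta>_def prob_space)
    also have "(\<integral>x. evalx q x \<partial>mu) \<le> (\<integral>x. evalx q0 x \<partial>mu)"
      using q D[OF d] unfolding sdp_optimal_def by blast
    finally show False using \<delta> by simp
  qed
  then show ?thesis by blast
qed

section \<open>Attainment at each level and convergence of the optimal values\<close>

lemma Xset_closed: "closed (Xset sx p)"
proof -
  have "Xset sx p = (\<Inter>s\<in>{1..sx}. {x. 0 \<le> evalx (p s) x})" by (auto simp: Xset_def)
  then show ?thesis
    by (auto intro!: closed_INT closed_Collect_le continuous_on_const continuous_on_evalx)
qed

text \<open>Compactness guarantees an optimal solution at each level whose feasible set is nonempty;
  an undefined level gives the empty set.\<close>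

lemma compact_lev_feasible:
  assumes "Xset sx p \<subseteq> Bset"
  shows "compact (lev_feasible sx p \<Phi>d e d)"
proof (cases "\<Phi>d d")
  case None
  then show ?thesis by (simp add: lev_feasible_def)
next
  case (Some q)
  then have "lev_feasible sx p \<Phi>d e d = Bset \<inter> (Xset sx p \<inter> {x. evalx q x \<le> e})"
    using assms by (auto simp: lev_feasible_def)
  then show ?thesis
    by (simp add: compact_Int_closed compact_Bset closed_Int Xset_closed closed_Collect_le
        continuous_on_const continuous_on_evalx)
qed

text \<open>\<open>x\<close> and \<open>l\<close> are arbitrary selections, so the conclusion covers
  every choice of optimal solutions and minimising indices; \<open>x_opt\<close> constrains
  \<open>x\<close> only where an optimal solution exists.\<close>

theorem theorem3p4:
  fixes f :: "('n::finite) rpoly"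
    and g :: "('n + 'p::finite) rpoly"
    and p :: "nat \<Rightarrow> 'n rpoly" and sx :: nat
    and h :: "nat \<Rightarrow> ('n + 'p) rpoly" and m :: nat
    and \<Phi>d :: "nat \<Rightarrow> 'n rpoly option"
    and x :: "real \<Rightarrow> nat \<Rightarrow> real ^ 'n"
    and l :: "real \<Rightarrow> nat \<Rightarrow> nat"
    and \<epsilon> :: real
  assumes h0: "h 0 = 1"
    and X_sub: "Xset sx p \<subseteq> Bset"
    and feasible: "sip_feasible sx p m h g \<noteq> {}"
    and K_compact: "compact (Kset m h)"
    and arch: "archimedean_family ({1..m} <+> (UNIV :: 'n set)) (case_sum h theta)"
    and Y_nonempty: "\<forall>x\<in>Bset. Yset m h x \<noteq> {}"
    and sdp_solvable: "\<exists>d1. \<forall>d\<ge>d1. \<exists>q. sdp_optimal m h g d q"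
    and Phid_Some: "\<forall>d q. \<Phi>d d = Some q \<longrightarrow> sdp_optimal m h g d q"
    and Phid_None: "\<forall>d. \<Phi>d d = None \<longrightarrow> \<not> (\<exists>q. sdp_optimal m h g d q)"
    and X_closure: "\<exists>U. open U \<and> Xset sx p = closure U"
    and x_opt: "\<forall>e\<ge>0. \<forall>d\<ge>1. (\<exists>z. opt_sol f (lev_feasible sx p \<Phi>d e d) z) \<longrightarrow>
                  opt_sol f (lev_feasible sx p \<Phi>d e d) (x e d)"
    and l_min: "\<forall>e\<ge>0. \<forall>d\<ge>1. l e d \<in> {1..d} \<and> f_lev sx p f \<Phi>d e (l e d) = f_tilde sx p f \<Phi>d e d"
    and eps: "\<epsilon> > 0"
  shows "(\<exists>d\<^sub>\<epsilon>\<ge>1. \<forall>d\<ge>d\<^sub>\<epsilon>.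
            ereal (evalx f (x \<epsilon> (l \<epsilon> d))) = f_tilde sx p f \<Phi>d \<epsilon> d \<and>
            f_tilde sx p f \<Phi>d \<epsilon> d < opt_val f (sip_feasible sx p m h g) + ereal \<epsilon>) \<and>
         ((\<exists>xs. opt_sol f (sip_feasible sx p m h g) xs \<and> Phi m h g xs < 0) \<longrightarrow>
          (\<exists>d\<^sub>0\<ge>1. \<forall>d\<ge>d\<^sub>0.
            opt_val f (sip_feasible sx p m h g) \<le> ereal (evalx f (x 0 (l 0 d))) \<and>
            ereal (evalx f (x 0 (l 0 d))) = f_tilde sx p f \<Phi>d 0 d \<and>
            f_tilde sx p f \<Phi>d 0 d < opt_val f (sip_feasible sx p m h g) + ereal \<epsilon>))"
proof -
  let ?S = "sip_feasible sx p m h g"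
  \<comment> \<open>Common core of both parts: used with tolerance \<open>\<epsilon>\<close> at a
    nearly optimal point, and with tolerance 0 at an optimal point where \<open>Phi\<close> is
    negative.\<close>
  have eventually_below:
    "\<exists>d0\<ge>1. \<forall>d\<ge>d0. x e (l e d) \<in> lev_feasible sx p \<Phi>d e (l e d) \<and>
       ereal (evalx f (x e (l e d))) = f_tilde sx p f \<Phi>d e d \<and> f_tilde sx p f \<Phi>d e d < ereal t"
    if e: "e \<ge> 0" "c < e" and x0: "x0 \<in> Xset sx p" "evalx f x0 < t"
      and g_x0: "\<And>y. y \<in> Yset m h x0 \<Longrightarrow> evalxy g x0 y < c" for e c t x0
  proof -
    obtain U where U: "open U" "Xset sx p = closure U" using X_closure by blast
    \<comment> \<open>Points over which \<open>g\<close> reaches \<open>c\<close>. As a projection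
      of a compact set it is closed, so its complement contains a neighbourhood of
      \<open>x0\<close>, on whose part in the cube all fibres satisfy \<open>g < c\<close>.\<close>
    define C where "C = fst ` (Kset m h \<inter> {z. c \<le> evalxy g (fst z) (snd z)})"
    have "closed {z. c \<le> evalxy g (fst z) (snd z)}"
      by (intro closed_Collect_le continuous_on_const continuous_on_evalxy)
    then have "compact C" unfolding C_def
      by (intro compact_continuous_image continuous_on_fst continuous_on_id compact_Int_closed K_compact)
    then have W_open: "open ({x. evalx f x < t} - C)"
      by (intro open_Diff compact_imp_closed open_Collect_less continuous_on_const continuous_on_evalx)
    have "x0 \<notin> C" using g_x0 by (force simp: C_def mem_Kset_iff)
    \<comment> \<open>\<open>x0\<close> may lie on the boundary of \<open>U\<close>; an open set
      meeting the closure of \<open>U\<close> meets \<open>U\<close> itself.\<close>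
    then have "closure U \<inter> ({x. evalx f x < t} - C) \<noteq> {}" using x0 U(2) by blast
    then have V_ne: "U \<inter> ({x. evalx f x < t} - C) \<noteq> {}"
      using open_Int_closure_eq_empty[OF W_open, of U] by (simp add: Int_commute)
    define V where "V = U \<inter> ({x. evalx f x < t} - C)"
    have V_X: "V \<subseteq> Xset sx p" unfolding V_def U(2) using closure_subset by blast
    have "evalxy g x y \<le> c" if "x \<in> V" "y \<in> Yset m h x" for x y
    proof (rule ccontr)
      assume "\<not> evalxy g x y \<le> c"
      moreover have "(x, y) \<in> Kset m h" using that V_X X_sub by (auto simp: mem_Kset_iff)
      ultimately have "x \<in> C" unfolding C_def by force
      then show False using that by (simp add: V_def)
    qed
    moreover have "open V" "V \<noteq> {}" "V \<subseteq> Bset"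
      using U(1) W_open V_ne V_X X_sub by (auto simp: V_def)
    ultimately obtain d0 where d0: "\<And>d q. d \<ge> d0 \<Longrightarrow> sdp_optimal m h g d q \<Longrightarrow> \<exists>x\<in>V. evalx q x \<le> e"
      using sdp_optimal_small_somewhere[OF h0 K_compact arch Y_nonempty, of V g c e] e(2) by blast
    obtain d1 where d1: "\<And>d. d \<ge> d1 \<Longrightarrow> \<exists>q. sdp_optimal m h g d q" using sdp_solvable by blast
    have "x e (l e d) \<in> lev_feasible sx p \<Phi>d e (l e d) \<and>
       ereal (evalx f (x e (l e d))) = f_tilde sx p f \<Phi>d e d \<and> f_tilde sx p f \<Phi>d e d < ereal t"
      if d: "d \<ge> max 1 (max d0 d1)" for d
    proof -
      obtain q where q: "\<Phi>d d = Some q" using Phid_None d1[of d] d by fastforce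
      then obtain x' where x': "x' \<in> V" "evalx q x' \<le> e" using d0[of d q] Phid_Some d by auto
      then have "x' \<in> lev_feasible sx p \<Phi>d e d" using V_X q by (auto simp: lev_feasible_def)
      then have "f_lev sx p f \<Phi>d e d \<le> ereal (evalx f x')"
        unfolding f_lev_def opt_val_def by (rule INF_lower)
      moreover have "evalx f x' < t" using x'(1) by (simp add: V_def)
      moreover have "f_tilde sx p f \<Phi>d e d \<le> f_lev sx p f \<Phi>d e d"
        unfolding f_tilde_def using d by (intro Min_le) auto
      ultimately have below: "f_tilde sx p f \<Phi>d e d < ereal t"
        by (meson le_less_trans less_ereal.simps(1) order_trans)
      let ?L = "lev_feasible sx p \<Phi>d e (l e d)"
      have l: "l e d \<ge> 1" "opt_val f ?L = f_tilde sx p f \<Phi>d e d"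
        using l_min e(1) d by (auto simp: f_lev_def)
      \<comment> \<open>An infeasible level has value infinity, so a finite bound on the minimum
        forces the selected level to be feasible.\<close>
      then have "?L \<noteq> {}" using below by (auto simp: opt_val_def top_ereal_def)
      then have "opt_sol f ?L (x e (l e d))"
        using x_opt e(1) l(1) opt_sol_exists[OF compact_lev_feasible[OF X_sub]] by blast
      from opt_sol_opt_val[OF this] show ?thesis using l(2) below by simp
    qed
    then show ?thesis by (intro exI[of _ "max 1 (max d0 d1)"]) auto
  qed
  have S_X: "?S \<subseteq> Xset sx p" by (auto simp: sip_feasible_def)
  \<comment> \<open>\<open>f\<close> is bounded on the cube, so the value is a real number and can
    enter the real bound \<open>t\<close> above.\<close>
  obtain v where v: "opt_val f ?S = ereal v"
  proof -
    obtain z where z: "z \<in> ?S" using feasible by blast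
    have "compact (evalx f ` Bset)"
      by (rule compact_continuous_image[OF continuous_on_evalx compact_Bset])
    then obtain C where C: "\<And>x. x \<in> Bset \<Longrightarrow> \<bar>evalx f x\<bar> \<le> C"
      using compact_imp_bounded by (fastforce simp: bounded_iff)
    have "opt_val f ?S \<le> ereal (evalx f z)" unfolding opt_val_def by (rule INF_lower[OF z])
    moreover have "ereal (- C) \<le> opt_val f ?S"
      unfolding opt_val_def using C S_X X_sub by (intro INF_greatest) (force simp: abs_le_iff)
    ultimately show ?thesis using that by (cases "opt_val f ?S") auto
  qed
  have part_a: "\<exists>d0\<ge>1. \<forall>d\<ge>d0. x \<epsilon> (l \<epsilon> d) \<in> lev_feasible sx p \<Phi>d \<epsilon> (l \<epsilon> d) \<and>
       ereal (evalx f (x \<epsilon> (l \<epsilon> d))) = f_tilde sx p f \<Phi>d \<epsilon> d \<and> f_tilde sx p f \<Phi>d \<epsilon> d < ereal (v + \<epsilon>)"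
  proof -
    \<comment> \<open>No minimiser is assumed here: a feasible point with value below
      \<open>v + \<epsilon>\<close> suffices, and there
      \<open>g \<le> 0 < \<epsilon> / 2\<close>.\<close>
    have "opt_val f ?S < ereal (v + \<epsilon>)" using v eps by simp
    then obtain x0 where x0: "x0 \<in> ?S" "evalx f x0 < v + \<epsilon>"
      unfolding opt_val_def by (auto simp: INF_less_iff)
    show ?thesis
      using x0 S_X eps by (intro eventually_below[of \<epsilon> "\<epsilon> / 2" x0]) (force simp: sip_feasible_def)+
  qed
  have part_b: "\<exists>d0\<ge>1. \<forall>d\<ge>d0. x 0 (l 0 d) \<in> lev_feasible sx p \<Phi>d 0 (l 0 d) \<and>
       ereal (evalx f (x 0 (l 0 d))) = f_tilde sx p f \<Phi>d 0 d \<and> f_tilde sx p f \<Phi>d 0 d < ereal (v + \<epsilon>)"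
    if xs: "opt_sol f ?S xs" "Phi m h g xs < 0" for xs
  \<comment> \<open>Half of a negative number lies strictly between it and 0, giving both strict
    inequalities that are required.\<close>
  proof (rule eventually_below[of 0 "Phi m h g xs / 2" xs])
    have xs_S: "xs \<in> ?S" and "evalx f xs = v"
      using opt_sol_opt_val[OF xs(1)] v by simp_all
    then show "xs \<in> Xset sx p" "evalx f xs < v + \<epsilon>" using S_X eps by auto
    show "evalxy g xs y < Phi m h g xs / 2" if y: "y \<in> Yset m h xs" for y
    proof -
      \<comment> \<open>Real suprema are meaningful only for sets bounded above; feasibility of
        \<open>xs\<close> supplies the bound 0.\<close>
      have "bdd_above (evalxy g xs ` Yset m h xs)"
        by (rule bdd_aboveI[of _ 0]) (use xs_S in \<open>auto simp: sip_feasible_def\<close>)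
      then have "evalxy g xs y \<le> Phi m h g xs"
        unfolding Phi_def by (rule cSUP_upper[OF y])
      then show ?thesis using xs(2) by simp
    qed
  qed (use xs in auto)
  \<comment> \<open>At tolerance 0 the level sets are inner approximations: each polynomial chosen
    by \<open>\<Phi>d\<close> dominates \<open>g\<close> over the cube, so their points are feasible
    for the original problem.\<close>
  have lower: "opt_val f ?S \<le> ereal (evalx f z)" if z: "z \<in> lev_feasible sx p \<Phi>d 0 d" for z d
  proof -
    obtain q where q: "\<Phi>d d = Some q" "evalx q z \<le> 0" and z_X: "z \<in> Xset sx p"
      using z by (auto simp: lev_feasible_def)
    obtain \<sigma> \<psi> where "sdp_feasible m h g d q \<sigma> \<psi>"
      using Phid_Some q(1) unfolding sdp_optimal_def by blast
    then have "evalxy g z y \<le> evalx q z" if "y \<in> Yset m h z" for y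
      by (rule sdp_feasible_imp_ge) (use h0 z_X X_sub that in \<open>auto simp: mem_Kset_iff\<close>)
    then have "evalxy g z y \<le> 0" if "y \<in> Yset m h z" for y using q(2) that order_trans by blast
    then have "z \<in> ?S" using z_X by (simp add: sip_feasible_def)
    then show ?thesis unfolding opt_val_def by (rule INF_lower)
  qed
  show ?thesis
    unfolding v plus_ereal.simps using part_a part_b lower[unfolded v] by meson
qed

end
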